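(* For every initial condition $(x_0,\gamma_0)\in\mathcal X\times\mathcal Y$ there exists an absolutely continuous map $t\mapsto(x(t),\gamma(t))\in\mathcal X\times\mathcal Y$ on $[0,\infty)$ with $(x(0),\gamma(0))=(x_0,\gamma_0)$ satisfying, for almost every $t$, $$\dot x(t)\in -\nabla^2R_x(x(t))^{-1}\big(\partial_xL(x(t),\gamma(t))+\mathcal N_{\mathcal X}(x(t))\big),\qquad \dot\gamma(t)\in \nabla^2R_\gamma(\gamma(t))^{-1}\big(\partial_\gamma^+L(x(t),\gamma(t))-\mathcal N_{\mathcal Y}(\gamma(t))\big).$$
   Context: Setting. $\mathcal X\subseteq\mathbb R^n$, $\mathcal Y\subseteq\mathbb R^m$ are nonempty, convex and compact. $L:\mathbb R^n\times\mathbb R^m\to[-\infty,+\infty]$ is convex in $x\in\mathbb R^n$ and concave in $\gamma\in\mathbb R^m$. For $(x,\gamma)\in\mathcal X\times\mathcal Y$, $\partial_xL(x,\gamma)=\{g\in\mathbb R^n: L(y,\gamma)\ge L(x,\gamma)+\langle g,y-x\rangle\ \forall y\in\mathbb R^n\}$ and $\partial_\gamma^+L(x,\gamma)=\{g\in\mathbb R^m: L(x,\delta)\le L(x,\gamma)+\langle g,\delta-\gamma\rangle\ \forall \delta\in\mathbb R^m\}$. A saddle point is $(x^*,\gamma^* )\in\mathcal X\times\mathcal Y$ with $L(x^*,\gamma)\le L(x^*,\gamma^* )\le L(x,\gamma^* )$ for all $x\in\mathcal X,\gamma\in\mathcal Y$; $\mathcal S$ is the set of saddle points. Standing assumptions.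 (A1) $\mathcal S$ is nonempty and compact, and for every $(x,\gamma)\in(\mathcal X\times\mathcal Y)\setminus\mathcal S$ there is $(x^*,\gamma^* )\in\mathcal S$ with $L(x^*,\gamma)<L(x^*,\gamma^* )$ or $L(x^*,\gamma^* )<L(x,\gamma^* )$. (A2) For each $x\in\mathcal X$, $L(x,\cdot)$ is upper semicontinuous on $\mathbb R^m$; for each $\gamma\in\mathcal Y$, $L(\cdot,\gamma)$ is lower semicontinuous on $\mathbb R^n$. (A3) For each $(x,\gamma)\in\mathcal X\times\mathcal Y$, $\partial_xL(x,\gamma)\times\partial_\gamma^+L(x,\gamma)$ is nonempty, and there is $G>0$ such that all elements of $\partial_xL(x,\gamma)$ and $\partial^+_\gamma L(x,\gamma)$, for all $(x,\gamma)\in\mathcal X\times\mathcal Y$, have norm at most $G$. $R_x$ (on $\mathbb R^n$) and $R_\gamma$ (on $\mathbb R^m$) are extended-real-valued functions, twice continuously differentiable and $\sigma_R$-strongly convex ($\sigma_R>0$) on open sets containing $\mathcal X$ and $\mathcal Y$ respectively. Tangent and normal cones of a closed convex set $\mathcal C$ at $x\in \mathcal C$: $\mathcal T_{\mathcal C}(x)=\{v: v=\lim_k (x_k-x)/t_k,\ x_k\in\mathcal C,\ t_k\downarrow0\}$ and $\mathcal N_{\mathcal C}(x)=\{\eta:\langle\eta,v\rangle\le0\ \forall v\in\mathcal T_{\mathcal C}(x)\}$. *)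

theory Defs
  imports "HOL-Analysis.Analysis"
begin

section \<open>Convex analysis of extended-real-valued functions\<close>

text \<open>The library's \<^const>\<open>convex_on\<close> is for real-valued functions. For values in
  \<open>[-\<infinity>, \<infinity>]\<close> convexity is convexity of the epigraph (a subset of
  \<open>'a \<times> real\<close>), which avoids any convention for \<open>\<infinity> - \<infinity>\<close>.\<close>

definition convex_ereal :: "('a::real_vector \<Rightarrow> ereal) \<Rightarrow> bool" where
  "convex_ereal f \<longleftrightarrow> convex {(x, r::real). f x \<le> ereal r}"

definition concave_ereal :: "('a::real_vector \<Rightarrow> ereal) \<Rightarrow> bool" where
  "concave_ereal f \<longleftrightarrow> convex {(x, r::real). ereal r \<le> f x}"

definition lsc :: "('a::topological_space \<Rightarrow> ereal) \<Rightarrow> bool" where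
  "lsc f \<longleftrightarrow> (\<forall>x. f x \<le> Liminf (at x) f)"

definition usc :: "('a::topological_space \<Rightarrow> ereal) \<Rightarrow> bool" where
  "usc f \<longleftrightarrow> (\<forall>x. Limsup (at x) f \<le> f x)"

definition subdifferential :: "('a::real_inner \<Rightarrow> ereal) \<Rightarrow> 'a \<Rightarrow> 'a set" where
  "subdifferential f x = {g. \<forall>y. f y \<ge> f x + ereal (g \<bullet> (y - x))}"

definition superdifferential :: "('a::real_inner \<Rightarrow> ereal) \<Rightarrow> 'a \<Rightarrow> 'a set" where
  "superdifferential f x = {g. \<forall>y. f y \<le> f x + ereal (g \<bullet> (y - x))}"

definition saddle_points :: "'a set \<Rightarrow> 'b set \<Rightarrow> ('a \<Rightarrow> 'b \<Rightarrow> ereal) \<Rightarrow> ('a \<times> 'b) set" where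
  "saddle_points X Y L = {(xs, \<gamma>s). xs \<in> X \<and> \<gamma>s \<in> Y \<and>
     (\<forall>x\<in>X. \<forall>\<gamma>\<in>Y. L xs \<gamma> \<le> L xs \<gamma>s \<and> L xs \<gamma>s \<le> L x \<gamma>s)}"

definition tangent_cone :: "'a::real_normed_vector set \<Rightarrow> 'a \<Rightarrow> 'a set" where
  "tangent_cone C x = {v. \<exists>(z :: nat \<Rightarrow> 'a) (t :: nat \<Rightarrow> real).
     (\<forall>k. z k \<in> C) \<and> (\<forall>k. t k > 0) \<and> decseq t \<and> t \<longlonglongrightarrow> 0 \<and>
     (\<lambda>k. (z k - x) /\<^sub>R t k) \<longlonglongrightarrow> v}"

definition normal_cone :: "'a::real_inner set \<Rightarrow> 'a \<Rightarrow> 'a set" where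
  "normal_cone C x = {\<eta>. \<forall>v\<in>tangent_cone C x. \<eta> \<bullet> v \<le> 0}"

section \<open>Twice continuous differentiability and strong convexity\<close>

definition gradient :: "('a::real_inner \<Rightarrow> real) \<Rightarrow> 'a \<Rightarrow> 'a" where
  "gradient f x = (THE D. GDERIV f x :> D)"

definition hessian :: "(real ^ 'n \<Rightarrow> real) \<Rightarrow> real ^ 'n \<Rightarrow> real ^ 'n ^ 'n" where
  "hessian f x = jacobian (gradient f) (at x)"

text \<open>Intended for open sets \<open>U\<close>.\<close>

definition C2_on :: "(real ^ 'n) set \<Rightarrow> (real ^ 'n \<Rightarrow> real) \<Rightarrow> bool" where
  "C2_on U f \<longleftrightarrow> (\<forall>x\<in>U. f differentiable (at x)) \<and>
     (\<forall>x\<in>U. gradient f differentiable (at x)) \<and> continuous_on U (hessian f)"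

text \<open>As for \<^const>\<open>convex_on\<close>, the domain is required to be convex. For a compact convex
  \<open>X\<close> this loses nothing: each open set containing \<open>X\<close> contains a convex open set
  containing \<open>X\<close>.\<close>

definition strongly_convex_on :: "real \<Rightarrow> 'a::real_normed_vector set \<Rightarrow> ('a \<Rightarrow> real) \<Rightarrow> bool" where
  "strongly_convex_on \<sigma> U f \<longleftrightarrow> convex U \<and>
     (\<forall>x\<in>U. \<forall>y\<in>U. \<forall>u\<ge>0. \<forall>v\<ge>0. u + v = 1 \<longrightarrow>
        f (u *\<^sub>R x + v *\<^sub>R y) \<le> u * f x + v * f y - \<sigma> / 2 * u * v * (norm (x - y))\<^sup>2)"

section \<open>Absolutely continuous curves\<close>

text \<open>The \<open>\<epsilon>\<close>-\<open>\<delta>\<close> notion on an interval \<open>I\<close>, which may be unbounded (the library's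
  \<^const>\<open>absolutely_continuous\<close> is about measures). A pair \<open>(a, b)\<close> in \<open>D\<close> stands for the
  interval from \<open>a\<close> to \<open>b\<close>. On \<open>{0..}\<close> this implies absolute continuity on each compact
  subinterval.\<close>

definition absolutely_continuous_on :: "real set \<Rightarrow> (real \<Rightarrow> 'a::metric_space) \<Rightarrow> bool" where
  "absolutely_continuous_on I f \<longleftrightarrow>
     (\<forall>\<epsilon>>0. \<exists>\<delta>>0. \<forall>D :: (real \<times> real) set.
        finite D \<and> (\<forall>(a, b)\<in>D. a < b \<and> {a..b} \<subseteq> I) \<and>
        pairwise (\<lambda>(a, b) (c, d). {a<..<b} \<inter> {c<..<d} = {}) D \<and>
        (\<Sum>(a, b)\<in>D. b - a) < \<delta> \<longrightarrow>
        (\<Sum>(a, b)\<in>D. dist (f a) (f b)) < \<epsilon>)"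

end

theory Submission
  imports Defs
begin

text \<open>
  The vector field jumps, since subgradients are set-valued, and it contains unbounded normal cones,
  so the classical existence theorems for ordinary differential equations do not apply. The way out
  is to describe the right-hand side by inequalities that are linear in the velocity and continuous
  in the state. Write \<open>z = (x, \<gamma>)\<close>, \<open>Z = X \<times> Y\<close>, \<open>p z = (\<nabla>Rx x, \<nabla>R\<gamma> \<gamma>)\<close>, and let
  \<open>\<Phi> (x, \<gamma>) (y, \<delta>) = L y \<gamma> - L x \<delta>\<close>. The differential inclusion holds at a time \<open>t\<close> at which
  \<open>z\<close> is differentiable as soon as the vector \<open>w = - (p \<circ> z)' t\<close> satisfies
  \<open>w \<bullet> (y - z t) \<le> \<Phi> (z t) y\<close> for all \<open>y \<in> Z\<close>. Indeed, moving only one component of \<open>y\<close> says that the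
  components of \<open>w\<close> are subgradients of \<open>L\<close> in \<open>x\<close> and of \<open>- L\<close> in \<open>\<gamma>\<close> relative to \<open>X\<close> and \<open>Y\<close>; a
  relative subgradient is a genuine subgradient plus a normal vector
  (\<open>restricted_subgradient_decomposition\<close>), and \<open>(p \<circ> z)'\<close> is the Hessian applied to the velocity,
  where strong convexity makes the Hessian invertible (\<open>matrix_inv_hessian_mult\<close>).

  A curve with this property is a limit of mirror descent sequences (\<open>mirror_step\<close>). Bounded
  subgradients and strong convexity make them uniformly Lipschitz up to the step size, so they have
  a Lipschitz pointwise limit. The step inequalities survive summation over a short time interval
  and then the passage to the limit, because the increments of \<open>p\<close> enter linearly and \<open>\<Phi>\<close> is
  continuous; this is \<open>mirror_flow_existence\<close>, which involves no weak compactness and no integration of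
  selections. Dividing by the length of the interval gives the inequality for \<open>w\<close> wherever the
  limit curve is differentiable. As the limit is Lipschitz, that is almost everywhere
  (\<open>lipschitz_differentiable_ae\<close>, derived from the Vitali covering theorem).
\<close>

section \<open>Almost everywhere differentiability of Lipschitz curves\<close>

text \<open>The engine of the differentiation theorem: a local comparison of two measures on arbitrarily
  small balls around the points of \<open>E\<close> becomes a global one on an open set that carries \<open>E\<close> up to
  a null set, because a Vitali cover has a countable disjoint subfamily that exhausts \<open>E\<close> and both
  measures are additive along it. The set \<open>E\<close> may be non-measurable, as outer measure is all
  that the application has to control. The points of \<open>E\<close> lie in the closed balls, not always in the
  open ones, so that intervals with an endpoint at the given point, as in a difference quotient,
  are admitted.\<close>

lemma vitali_measure_comparison:
  fixes E Q :: "'a::euclidean_space set"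
  assumes sets_\<alpha>: "sets \<alpha> = sets borel" and sets_\<beta>: "sets \<beta> = sets borel"
    and Q: "open Q" "E \<subseteq> Q"
    and fine: "\<And>x d. x \<in> E \<Longrightarrow> 0 < d \<Longrightarrow> \<exists>c r. 0 < r \<and> r < d \<and> x \<in> cball c r \<and>
      emeasure \<alpha> (ball c r) \<le> emeasure \<beta> (ball c r)"
  obtains B where "open B" "B \<subseteq> Q" "negligible (E - B)" "emeasure \<alpha> B \<le> emeasure \<beta> B"
proof -
  define K where "K = {(c, r). 0 < r \<and> cball c r \<subseteq> Q \<and>
    emeasure \<alpha> (ball c r) \<le> emeasure \<beta> (ball c r)}"
  have cov: "\<exists>i. i \<in> K \<and> x \<in> cball (fst i) (snd i) \<and> snd i < d" if x: "x \<in> E" and "0 < d" for x d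
  proof -
    obtain e where e: "e > 0" "ball x e \<subseteq> Q"
      using x Q by (meson in_mono openE)
    obtain c r where cr: "0 < r" "r < min d (e / 2)" "x \<in> cball c r"
        "emeasure \<alpha> (ball c r) \<le> emeasure \<beta> (ball c r)"
      using fine[OF x, of "min d (e/2)"] \<open>0 < d\<close> e by auto
    have "cball c r \<subseteq> ball x e"
    proof
      fix y assume "y \<in> cball c r"
      then have "dist x y \<le> 2 * r"
        using cr(3) dist_triangle[of x y c] by (simp add: dist_commute)
      then show "y \<in> ball x e" using cr(2) by auto
    qed
    then have "(c, r) \<in> K" using cr e by (auto simp: K_def)
    then show ?thesis using cr by force
  qed
  obtain C where C: "countable C" "C \<subseteq> K"
      "pairwise (\<lambda>i j. disjnt (cball (fst i) (snd i)) (cball (fst j) (snd j))) C"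
      "negligible (E - (\<Union>i\<in>C. cball (fst i) (snd i)))"
  proof (rule Vitali_covering_theorem_cballs[of K snd E fst])
    show "0 < snd i" if "i \<in> K" for i using that by (auto simp: K_def)
  qed (use cov in blast)+
  define B where "B = (\<Union>i\<in>C. ball (fst i) (snd i))"
  have disj: "disjoint_family_on (\<lambda>i. ball (fst i) (snd i)) C"
    unfolding disjoint_family_on_def
  proof (intro ballI impI)
    fix i j assume "i \<in> C" "j \<in> C" "i \<noteq> j"
    then have "disjnt (cball (fst i) (snd i)) (cball (fst j) (snd j))"
      using C(3) by (auto simp: pairwise_def)
    then show "ball (fst i) (snd i) \<inter> ball (fst j) (snd j) = {}"
      using ball_subset_cball unfolding disjnt_def by blast
  qed
  show thesis
  proof
    show "open B" by (auto simp: B_def)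
    show "B \<subseteq> Q"
      using C(2) ball_subset_cball unfolding B_def K_def by fastforce
    \<comment> \<open>Passing from closed to open balls, to make \<open>B\<close> open, loses only countably many spheres.\<close>
    have "negligible (\<Union>i\<in>C. sphere (fst i) (snd i))"
      using C(1) by (auto intro!: negligible_countable_Union negligible_sphere)
    then have "negligible ((E - (\<Union>i\<in>C. cball (fst i) (snd i))) \<union> (\<Union>i\<in>C. sphere (fst i) (snd i)))"
      using C(4) by (rule negligible_Un[rotated])
    then show "negligible (E - B)"
      by (rule negligible_subset) (auto simp: B_def, force)
    have "emeasure \<alpha> B = (\<integral>\<^sup>+i. emeasure \<alpha> (ball (fst i) (snd i)) \<partial>count_space C)"
      unfolding B_def by (rule emeasure_UN_countable) (use C(1) disj sets_\<alpha> in auto)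
    also have "\<dots> \<le> (\<integral>\<^sup>+i. emeasure \<beta> (ball (fst i) (snd i)) \<partial>count_space C)"
      by (rule nn_integral_mono) (use C(2) in \<open>auto simp: K_def\<close>)
    also have "\<dots> = emeasure \<beta> B"
      unfolding B_def by (rule emeasure_UN_countable[symmetric]) (use C(1) disj sets_\<beta> in auto)
    finally show "emeasure \<alpha> B \<le> emeasure \<beta> B" .
  qed
qed

text \<open>For continuous \<open>f\<close> the Stieltjes measure has no atoms, so increments of \<open>f\<close> over open intervals
  are measures of these intervals.\<close>

lemma emeasure_interval_measure_ball:
  fixes f :: "real \<Rightarrow> real"
  assumes f: "mono f" "continuous_on UNIV f" and r: "0 < r"
  shows "emeasure (interval_measure f) (ball c r) = ennreal (f (c + r) - f (c - r))"
proof -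
  let ?\<nu> = "interval_measure f"
  have Icc: "emeasure ?\<nu> {a..b} = ennreal (f b - f a)" if "a \<le> b" for a b
    using emeasure_interval_measure_Icc[OF that _ f(2)] monoD[OF f(1)] by simp
  have "emeasure ?\<nu> {c - r, c + r} \<le> emeasure ?\<nu> {c - r} + emeasure ?\<nu> {c + r}"
    using emeasure_subadditive[of "{c - r}" ?\<nu> "{c + r}"] by (simp add: insert_commute)
  also have "\<dots> = 0"
    using Icc[of "c - r" "c - r"] Icc[of "c + r" "c + r"] by simp
  finally have null: "{c - r, c + r} \<in> null_sets ?\<nu>"
    by (auto simp: null_sets_def)
  have "ball c r = {c - r..c + r} - {c - r, c + r}"
    by (auto simp: ball_eq_greaterThanLessThan)
  then have "emeasure ?\<nu> (ball c r) = emeasure ?\<nu> {c - r..c + r}"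
    using emeasure_Diff_null_set[OF null, of "{c - r..c + r}"] by simp
  then show ?thesis using Icc[of "c - r" "c + r"] r by simp
qed

text \<open>Apply the comparison lemma twice, to Lebesgue measure \<open>\<lambda>\<close> and the Stieltjes measure \<open>\<nu>\<close> of \<open>f\<close>.
  For an open \<open>Q \<supseteq> E\<close> it gives open sets \<open>B2 \<subseteq> B1 \<subseteq> Q\<close>, both containing almost all of \<open>E\<close>, with
  \<open>\<nu> B1 \<le> u * \<lambda> B1\<close> and \<open>v * \<lambda> B2 \<le> \<nu> B2\<close>. Hence \<open>v * m \<le> v * \<lambda> B2 \<le> u * \<lambda> Q\<close> for the outer
  measure \<open>m\<close> of \<open>E\<close>; letting \<open>\<lambda> Q\<close> tend to \<open>m\<close> gives \<open>v * m \<le> u * m\<close>, which forces \<open>m = 0\<close>.\<close>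

lemma negligible_slope_gap:
  fixes f :: "real \<Rightarrow> real" and E :: "real set"
  assumes f: "mono f" "continuous_on UNIV f" and E: "bounded E" and uv: "0 \<le> u" "u < v"
    and low: "\<And>x d. x \<in> E \<Longrightarrow> 0 < d \<Longrightarrow>
      \<exists>a b. a \<le> x \<and> x \<le> b \<and> a < b \<and> b - a < d \<and> f b - f a \<le> u * (b - a)"
    and high: "\<And>x d. x \<in> E \<Longrightarrow> 0 < d \<Longrightarrow>
      \<exists>a b. a \<le> x \<and> x \<le> b \<and> a < b \<and> b - a < d \<and> v * (b - a) \<le> f b - f a"
  shows "negligible E"
proof -
  let ?\<nu> = "interval_measure f"
  let ?leb = "\<lambda>w. scale_measure (ennreal w) (lborel :: real measure)"
  have ball_of: "\<exists>c r. 0 < r \<and> r < d \<and> x \<in> cball c r \<and> P (c - r) (c + r)"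
    if "0 < d" and ex: "\<exists>a b. a \<le> x \<and> x \<le> b \<and> a < b \<and> b - a < d \<and> P a b" for x d :: real and P
  proof -
    obtain a b where ab: "a \<le> x" "x \<le> b" "a < b" "b - a < d" "P a b"
      using ex by (elim exE conjE)
    have "(a + b) / 2 - (b - a) / 2 = a" "(a + b) / 2 + (b - a) / 2 = b"
      by (simp_all add: field_simps)
    moreover have "x \<in> cball ((a + b) / 2) ((b - a) / 2)"
      using ab(1,2) by (simp add: dist_real_def abs_le_iff field_simps)
    ultimately show ?thesis
      using ab(3-5) by (intro exI[of _ "(a + b) / 2"] exI[of _ "(b - a) / 2"]) simp
  qed
  have lebball: "emeasure (?leb w) (ball c r) = ennreal (w * ((c + r) - (c - r)))"
    if "0 \<le> w" "0 < r" for w c r :: real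
    using that by (simp add: ball_eq_greaterThanLessThan ennreal_mult)
  have fine_low: "\<exists>c r. 0 < r \<and> r < d \<and> x \<in> cball c r \<and>
      emeasure ?\<nu> (ball c r) \<le> emeasure (?leb u) (ball c r)" if xd: "x \<in> E" "0 < d" for x d
  proof -
    obtain c r where cr: "0 < r" "r < d" "x \<in> cball c r" "f (c + r) - f (c - r) \<le> u * (c + r - (c - r))"
      using ball_of[OF xd(2) low[OF xd]] by auto
    then show ?thesis
      using emeasure_interval_measure_ball[OF f cr(1)] lebball[OF uv(1) cr(1)] ennreal_leI[OF cr(4)]
      by (intro exI[of _ c] exI[of _ r]) simp
  qed
  have fine_high: "\<exists>c r. 0 < r \<and> r < d \<and> x \<in> cball c r \<and>
      emeasure (?leb v) (ball c r) \<le> emeasure ?\<nu> (ball c r)" if xd: "x \<in> E" "0 < d" for x d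
  proof -
    obtain c r where cr: "0 < r" "r < d" "x \<in> cball c r" "v * (c + r - (c - r)) \<le> f (c + r) - f (c - r)"
      using ball_of[OF xd(2) high[OF xd]] by auto
    then show ?thesis
      using emeasure_interval_measure_ball[OF f cr(1)] lebball[OF _ cr(1), of v] uv ennreal_leI[OF cr(4)]
      by (intro exI[of _ c] exI[of _ r]) simp
  qed
  \<comment> \<open>The outer measure of \<open>E\<close>, written as an infimum over measurable supersets.\<close>
  define M where "M = {measure lebesgue T | T. E \<subseteq> T \<and> T \<in> lmeasurable}"
  define m where "m = Inf M"
  have M0: "x \<ge> 0" if "x \<in> M" for x using that by (auto simp: M_def)
  have Mne: "M \<noteq> {}"
  proof -
    obtain a where "E \<subseteq> cbox (-a) a" using bounded_subset_cbox_symmetric[OF E] by blast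
    then show ?thesis unfolding M_def by blast
  qed
  have m_le: "m \<le> measure lebesgue T" if "E \<subseteq> T" "T \<in> lmeasurable" for T
    unfolding m_def by (rule cInf_lower) (use that M0 in \<open>auto simp: M_def bdd_below_def\<close>)
  have m0: "m \<ge> 0" unfolding m_def by (rule cInf_greatest[OF Mne M0])
  have key: "v * m \<le> u * (m + e)" if "0 < e" for e
  proof -
    have "Inf M < m + e / 2" using that m_def by simp
    then obtain T where T: "E \<subseteq> T" "T \<in> lmeasurable" "measure lebesgue T < m + e / 2"
      using cInf_lessD[OF Mne] by (auto simp: M_def)
    obtain Q where Q0: "open Q" "T \<subseteq> Q" "Q - T \<in> lmeasurable" "emeasure lebesgue (Q - T) < ennreal (e / 2)"
      using sets_lebesgue_outer_open[OF fmeasurableD[OF T(2)] half_gt_zero[OF \<open>0 < e\<close>]] by metis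
    have "Q = T \<union> (Q - T)" using Q0(2) by blast
    then have Q3: "Q \<in> lmeasurable" using fmeasurable.Un[OF T(2) Q0(3)] by simp
    have "measure lebesgue Q \<le> measure lebesgue T + measure lebesgue (Q - T)"
      using measure_Un_le[of T lebesgue "Q - T"] T(2) Q0(3) \<open>Q = T \<union> (Q - T)\<close> by simp
    moreover have "measure lebesgue (Q - T) < e / 2"
      using Q0(3,4) that by (simp add: emeasure_eq_measure2 ennreal_less_iff)
    ultimately have Q: "open Q" "T \<subseteq> Q" "Q \<in> lmeasurable" "measure lebesgue Q < measure lebesgue T + e / 2"
      using Q0(1,2) Q3 by auto
    obtain B1 where B1: "open B1" "B1 \<subseteq> Q" "negligible (E - B1)" "emeasure ?\<nu> B1 \<le> emeasure (?leb u) B1"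
      by (rule vitali_measure_comparison[OF _ _ Q(1) subset_trans[OF T(1) Q(2)] fine_low]) auto
    obtain B2 where B2: "open B2" "B2 \<subseteq> B1" "negligible (E \<inter> B1 - B2)" "emeasure (?leb v) B2 \<le> emeasure ?\<nu> B2"
      by (rule vitali_measure_comparison[OF _ _ B1(1) Int_lower2 fine_high]) auto
    have lm: "B2 \<in> lmeasurable"
      by (rule fmeasurableI2[OF Q(3)]) (use B1 B2 in auto)
    have neg: "negligible (E - B2)"
      by (rule negligible_subset[OF negligible_Un[OF B1(3) B2(3)]]) auto
    have "m \<le> measure lebesgue (B2 \<union> (E - B2))"
      by (rule m_le[OF _ fmeasurable.Un[OF lm negligible_imp_measurable[OF neg]]]) blast
    also have "\<dots> \<le> measure lebesgue B2"
      using measure_Un_le[of B2 lebesgue "E - B2"] lm neg negligible_imp_measure0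
      by (metis add.right_neutral fmeasurableD negligible_imp_sets)
    finally have m_B2: "m \<le> measure lebesgue B2" .
    have em: "emeasure (?leb w) A = ennreal (w * measure lebesgue A)"
      if "A \<in> lmeasurable" "open A" "0 \<le> w" for A w
    proof -
      have "emeasure lborel A = emeasure lebesgue A" using that(2) by (simp)
      also have "\<dots> = ennreal (measure lebesgue A)"
        using that(1) by (simp add: emeasure_eq_measure2)
      finally show ?thesis using that(3) by (simp add: ennreal_mult)
    qed
    have "emeasure (?leb v) B2 \<le> emeasure ?\<nu> B2" by fact
    also have "\<dots> \<le> emeasure ?\<nu> B1" using B1 B2 by (intro emeasure_mono) auto
    also have "\<dots> \<le> emeasure (?leb u) B1" by fact
    also have "\<dots> \<le> emeasure (?leb u) Q" using B1 Q by (intro emeasure_mono) auto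
    finally have "v * measure lebesgue B2 \<le> u * measure lebesgue Q"
      using em[OF lm B2(1)] em[OF Q(3,1)] uv by (simp add: ennreal_le_iff)
    moreover have "v * m \<le> v * measure lebesgue B2" using m_B2 uv by (simp add: mult_left_mono)
    moreover have "u * measure lebesgue Q \<le> u * (m + e)" using Q T uv by (intro mult_left_mono) auto
    ultimately show ?thesis by linarith
  qed
  have "m \<le> 0"
  proof (rule ccontr)
    assume "\<not> m \<le> 0"
    then have mp: "m > 0" by simp
    \<comment> \<open>Small enough that \<open>u * e < (v - u) * m\<close>; the summand 1 covers the case \<open>u = 0\<close>.\<close>
    define e where "e = (v - u) * m / (u + 1)"
    have "e > 0" using mp uv by (simp add: e_def)
    have "u * e < (v - u) * m"
      using mp uv by (simp add: e_def field_simps)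
    with key[OF \<open>e > 0\<close>] show False by (simp add: algebra_simps)
  qed
  then have "m = 0" using m0 by simp
  show ?thesis unfolding negligible_outer
  proof (intro allI impI)
    fix e :: real assume "e > 0"
    then have "Inf M < e" using \<open>m = 0\<close> m_def by simp
    then show "\<exists>T. E \<subseteq> T \<and> T \<in> lmeasurable \<and> measure lebesgue T < e"
      using cInf_lessD[OF Mne] by (auto simp: M_def)
  qed
qed

text \<open>If the bounded slopes do not converge, their lower and upper limits differ, and two rationals fit
  in between. Rationals keep the family of exceptional sets countable.\<close>

lemma slope_gap_of_not_differentiable:
  fixes f :: "real \<Rightarrow> real"
  assumes bd: "\<And>y. y \<noteq> x \<Longrightarrow> \<bar>(f y - f x) / (y - x)\<bar> \<le> K"
    and nd: "\<not> f differentiable (at x)"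
  obtains u v :: rat where "u < v"
    "\<exists>\<^sub>F y in at x. (f y - f x) / (y - x) < of_rat u"
    "\<exists>\<^sub>F y in at x. of_rat v < (f y - f x) / (y - x)"
proof -
  define s where "s y = ereal ((f y - f x) / (y - x))" for y
  let ?l = "Liminf (at x) s" and ?L = "Limsup (at x) s"
  have ev: "\<forall>\<^sub>F y in at x. ereal (-K) \<le> s y \<and> s y \<le> ereal K"
    unfolding eventually_at_filter
  proof (rule always_eventually, intro allI impI)
    fix y assume "y \<noteq> x"
    from bd[OF this] have "- K \<le> (f y - f x) / (y - x)" "(f y - f x) / (y - x) \<le> K"
      by linarith+
    then show "ereal (- K) \<le> s y \<and> s y \<le> ereal K" by (simp add: s_def)
  qed
  have l: "ereal (-K) \<le> ?l" by (rule Liminf_bounded) (use ev in \<open>auto elim: eventually_mono\<close>)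
  have L: "?L \<le> ereal K" by (rule Limsup_bounded) (use ev in \<open>auto elim: eventually_mono\<close>)
  have lL: "?l \<le> ?L" by (rule Liminf_le_Limsup) simp
  have "?l \<noteq> ?L"
  proof
    assume eq: "?l = ?L"
    obtain D where D: "?l = ereal D"
      using l L unfolding eq by (cases ?L) auto
    have "(s \<longlongrightarrow> ereal D) (at x)"
      using Liminf_eq_Limsup[of "at x" s "ereal D"] D eq by simp
    then have "((\<lambda>y. (f y - f x) / (y - x)) \<longlongrightarrow> D) (at x)"
      unfolding s_def by simp
    then have "(f has_field_derivative D) (at x)"
      by (simp add: has_field_derivative_iff)
    then show False using nd by (auto simp: real_differentiable_def)
  qed
  then have "?l < ?L" using lL by simp
  then obtain a b where ab: "?l < ereal a" "a < b" "ereal b < ?L"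
    by (metis ereal_dense2 less_ereal.simps(1))
  obtain u :: rat where u: "a < of_rat u" "of_rat u < b"
    using of_rat_dense[OF ab(2)] by blast
  obtain v :: rat where v: "of_rat u < real_of_rat v" "of_rat v < b"
    using of_rat_dense[OF u(2)] by blast
  show thesis
  proof
    show "u < v" using v by (simp add: of_rat_less)
    show "\<exists>\<^sub>F y in at x. (f y - f x) / (y - x) < of_rat u"
    proof (rule ccontr)
      assume "\<not> ?thesis"
      then have "\<forall>\<^sub>F y in at x. ereal (of_rat u) \<le> s y"
        by (simp add: frequently_def s_def not_less)
      then have "ereal (of_rat u) \<le> ?l" by (rule Liminf_bounded)
      with ab u show False by (meson ereal_less_eq(3) leD less_le_trans order_less_imp_le)
    qed
    show "\<exists>\<^sub>F y in at x. of_rat v < (f y - f x) / (y - x)"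
    proof (rule ccontr)
      assume "\<not> ?thesis"
      then have "\<forall>\<^sub>F y in at x. s y \<le> ereal (of_rat v)"
        by (simp add: frequently_def s_def not_less)
      then have "?L \<le> ereal (of_rat v)" by (rule Limsup_bounded)
      with ab v show False by (meson ereal_less_eq(3) leD le_less_trans order_less_imp_le)
    qed
  qed
qed

lemma interval_of_frequently_slope:
  fixes f :: "real \<Rightarrow> real"
  assumes "\<exists>\<^sub>F y in at x. P ((f y - f x) / (y - x))" and "0 < d"
  shows "\<exists>a b. a \<le> x \<and> x \<le> b \<and> a < b \<and> b - a < d \<and> P ((f b - f a) / (b - a))"
proof -
  have "\<forall>\<^sub>F y in at x. y \<noteq> x \<and> dist y x < d"
    using \<open>0 < d\<close> by (auto simp: eventually_at)
  then obtain y where y: "P ((f y - f x) / (y - x))" "y \<noteq> x" "dist y x < d"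
    using frequently_eventually_conj[OF assms(1)] frequently_ex by fastforce
  show ?thesis
  proof (cases "x < y")
    case True
    then show ?thesis using y by (intro exI[of _ x] exI[of _ y]) (auto simp: dist_real_def)
  next
    case False
    have "(f x - f y) / (x - y) = (f y - f x) / (y - x)"
      using y(2) by (simp add: field_simps)
    then show ?thesis using y False by (intro exI[of _ y] exI[of _ x]) (auto simp: dist_real_def)
  qed
qed

text \<open>The points of non-differentiability are covered by countably many slope-gap sets, indexed by a
  bound on the point (the gap lemma needs bounded sets) and by the two rational slopes.\<close>

lemma lipschitz_mono_differentiable_ae:
  fixes f :: "real \<Rightarrow> real"
  assumes f: "mono f" and lip: "K-lipschitz_on UNIV f"
  shows "negligible {x. \<not> f differentiable (at x)}"
proof -
  define N where "N = (\<lambda>(k::nat, u::rat, v::rat). {x \<in> cball 0 (real k). u < v \<and>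
    (\<exists>\<^sub>F y in at x. (f y - f x) / (y - x) < of_rat u) \<and>
    (\<exists>\<^sub>F y in at x. of_rat v < (f y - f x) / (y - x))})"
  have slope0: "0 \<le> (f y - f x) / (y - x)" for x y
    using monoD[OF f, of x y] monoD[OF f, of y x]
    by (cases "x \<le> y") (auto simp: divide_nonneg_nonneg divide_nonpos_nonpos)
  have cont: "continuous_on UNIV f" using lip by (rule lipschitz_on_continuous_on)
  have N: "negligible (N p)" for p
  proof (cases p)
    case (fields k u v)
    show ?thesis
    proof (cases "0 < u \<and> u < v")
      case False
      have "N p = {}"
      proof (rule ccontr)
        assume "N p \<noteq> {}"
        then obtain x where x: "u < v" "\<exists>\<^sub>F y in at x. (f y - f x) / (y - x) < of_rat u"
          by (auto simp: N_def fields)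
        obtain y where "(f y - f x) / (y - x) < of_rat u" using x(2) frequently_ex by blast
        then have "0 < real_of_rat u" using slope0[of y x] by linarith
        then show False using False x by simp
      qed
      then show ?thesis by simp
    next
      case True
      show ?thesis
      proof (rule negligible_slope_gap[OF f cont, of _ "of_rat u" "of_rat v"])
        show "bounded (N p)"
          by (rule bounded_subset[OF bounded_cball[of 0 "real k"]]) (auto simp: N_def fields)
        show "0 \<le> real_of_rat u" "real_of_rat u < of_rat v"
          using True by (simp_all add: of_rat_less)
        fix x d :: real assume "x \<in> N p" and d: "0 < d"
        then have x: "\<exists>\<^sub>F y in at x. (f y - f x) / (y - x) < of_rat u"
          "\<exists>\<^sub>F y in at x. of_rat v < (f y - f x) / (y - x)" by (auto simp: N_def fields)
        show "\<exists>a b. a \<le> x \<and> x \<le> b \<and> a < b \<and> b - a < d \<and> f b - f a \<le> of_rat u * (b - a)"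
          using interval_of_frequently_slope[where P="\<lambda>s. s < of_rat u", OF x(1) d]
          by (force simp: field_simps)
        show "\<exists>a b. a \<le> x \<and> x \<le> b \<and> a < b \<and> b - a < d \<and> of_rat v * (b - a) \<le> f b - f a"
          using interval_of_frequently_slope[where P="\<lambda>s. of_rat v < s", OF x(2) d]
          by (force simp: field_simps)
      qed
    qed
  qed
  have "negligible (\<Union>p. N p)"
    by (rule negligible_countable_Union) (use N in auto)
  moreover have "{x. \<not> f differentiable (at x)} \<subseteq> (\<Union>p. N p)"
  proof
    fix x assume "x \<in> {x. \<not> f differentiable (at x)}"
    then have nd: "\<not> f differentiable (at x)" by simp
    have bd: "\<bar>(f y - f x) / (y - x)\<bar> \<le> K" if "y \<noteq> x" for y
      using lipschitz_onD[OF lip, of y x] that by (simp add: dist_real_def divide_le_eq)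
    obtain k :: nat where "\<bar>x\<bar> \<le> real k" using real_arch_simple by blast
    moreover obtain u v :: rat where "u < v"
        "\<exists>\<^sub>F y in at x. (f y - f x) / (y - x) < of_rat u"
        "\<exists>\<^sub>F y in at x. of_rat v < (f y - f x) / (y - x)"
      by (rule slope_gap_of_not_differentiable[OF bd nd])
    ultimately have "x \<in> N (k, u, v)" by (simp add: N_def)
    then show "x \<in> (\<Union>p. N p)" by blast
  qed
  ultimately show ?thesis using negligible_subset by blast
qed

text \<open>Adding \<open>K * t\<close> to a coordinate of a \<open>K\<close>-Lipschitz curve makes it monotone without affecting
  differentiability.\<close>

theorem lipschitz_differentiable_ae:
  fixes f :: "real \<Rightarrow> 'a::euclidean_space"
  assumes lip: "K-lipschitz_on UNIV f"
  shows "negligible {t. \<not> f differentiable (at t)}"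
proof -
  have K: "K \<ge> 0" using lip lipschitz_on_nonneg by blast
  have comp: "negligible {t. \<not> (\<lambda>s. f s \<bullet> b) differentiable (at t)}" if b: "b \<in> Basis" for b
  proof -
    define g where "g t = f t \<bullet> b + K * t" for t
    have fb: "\<bar>f t \<bullet> b - f s \<bullet> b\<bar> \<le> K * \<bar>t - s\<bar>" for s t
      using Basis_le_norm[OF b, of "f t - f s"] lipschitz_onD[OF lip, of t s]
      by (simp add: inner_diff_left dist_norm)
    have "mono g"
    proof
      fix s t :: real assume "s \<le> t"
      then show "g s \<le> g t" using fb[of t s] by (simp add: g_def abs_le_iff algebra_simps)
    qed
    moreover have "(2 * K)-lipschitz_on UNIV g"
    proof (rule lipschitz_onI)
      fix s t :: real
      have "\<bar>K * s - K * t\<bar> = K * \<bar>s - t\<bar>" using K by (simp add: abs_mult flip: right_diff_distrib)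
      then show "dist (g s) (g t) \<le> 2 * K * dist s t"
        using fb[of s t] by (simp add: g_def dist_real_def)
    qed (use K in simp)
    ultimately have "negligible {t. \<not> g differentiable (at t)}"
      by (rule lipschitz_mono_differentiable_ae)
    moreover have "(\<lambda>s. f s \<bullet> b) differentiable (at t)" if "g differentiable (at t)" for t
    proof -
      have "(\<lambda>s. g s - K * s) differentiable (at t)" using that by (intro derivative_intros)
      then show ?thesis by (simp add: g_def)
    qed
    ultimately show ?thesis by (elim negligible_subset) auto
  qed
  have "negligible (\<Union>b\<in>Basis. {t. \<not> (\<lambda>s. f s \<bullet> b) differentiable (at t)})"
    by (rule negligible_Union) (use comp in auto)
  moreover have "{t. \<not> f differentiable (at t)} \<subseteq> (\<Union>b\<in>Basis. {t. \<not> (\<lambda>s. f s \<bullet> b) differentiable (at t)})"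
    using differentiable_componentwise_within[of f _ UNIV] by auto
  ultimately show ?thesis using negligible_subset by blast
qed

section \<open>Existence of mirror flows\<close>

text \<open>The step minimises \<open>f \<bullet> y + R y - p z \<bullet> y\<close> over the compact set \<open>Z\<close>; the inequality is the
  first-order optimality condition along the segment from the minimiser \<open>z'\<close> to \<open>y\<close>.\<close>

lemma mirror_step:
  fixes Z :: "'a::euclidean_space set"
  assumes Z: "compact Z" "convex Z"
    and R: "\<And>z. z \<in> Z \<Longrightarrow> (R has_derivative (\<lambda>v. p z \<bullet> v)) (at z within Z)"
    and z: "z \<in> Z"
  obtains z' where "z' \<in> Z" "\<And>y. y \<in> Z \<Longrightarrow> (p z - p z') \<bullet> (y - z') \<le> f \<bullet> (y - z')"
proof -
  define \<phi> where "\<phi> y = f \<bullet> y + R y - p z \<bullet> y" for y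
  have der: "(\<phi> has_derivative (\<lambda>v. f \<bullet> v + p y \<bullet> v - p z \<bullet> v)) (at y within Z)" if "y \<in> Z" for y
    unfolding \<phi>_def by (auto intro!: derivative_eq_intros R[OF that])
  have "continuous_on Z \<phi>"
    using der has_derivative_continuous continuous_on_eq_continuous_within by blast
  then obtain z' where z': "z' \<in> Z" "\<And>y. y \<in> Z \<Longrightarrow> \<phi> z' \<le> \<phi> y"
    using continuous_attains_inf[OF Z(1), of \<phi>] z by blast
  show thesis
  proof
    fix y assume y: "y \<in> Z"
    define c where "c s = z' + s *\<^sub>R (y - z')" for s :: real
    have c: "c s \<in> Z" if "s \<in> {0..1}" for s
    proof -
      have "c s = (1 - s) *\<^sub>R z' + s *\<^sub>R y" by (simp add: c_def algebra_simps)
      then show ?thesis using convexD[OF Z(2) z'(1) y, of "1 - s" s] that by auto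
    qed
    have "(c has_derivative (\<lambda>s. s *\<^sub>R (y - z'))) (at 0 within {0..1})"
      unfolding c_def by (auto intro!: derivative_eq_intros)
    moreover have "(\<phi> has_derivative (\<lambda>v. f \<bullet> v + p z' \<bullet> v - p z \<bullet> v)) (at (c 0) within c ` {0..1})"
      using der[OF z'(1)] c by (auto simp: c_def intro: has_derivative_subset)
    ultimately have "((\<lambda>s. \<phi> (c s)) has_derivative
        (\<lambda>s. f \<bullet> (s *\<^sub>R (y - z')) + p z' \<bullet> (s *\<^sub>R (y - z')) - p z \<bullet> (s *\<^sub>R (y - z')))) (at 0 within {0..1})"
      by (rule has_derivative_in_compose)
    then have "((\<lambda>s. \<phi> (c s)) has_field_derivative (f + p z' - p z) \<bullet> (y - z')) (at 0 within {0..1})"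
      unfolding has_field_derivative_def by (rule has_derivative_eq_rhs) (auto simp: algebra_simps inner_add_left inner_diff_left)
    then have lim: "((\<lambda>s. (\<phi> (c s) - \<phi> (c 0)) / (s - 0)) \<longlongrightarrow> (f + p z' - p z) \<bullet> (y - z')) (at 0 within {0..1})"
      by (simp add: has_field_derivative_iff)
    have "0 \<le> (f + p z' - p z) \<bullet> (y - z')"
    proof (rule tendsto_lowerbound[OF lim])
      show "\<forall>\<^sub>F s in at 0 within {0..1}. 0 \<le> (\<phi> (c s) - \<phi> (c 0)) / (s - 0)"
        unfolding eventually_at_filter
        by (rule always_eventually) (use c z'(2) in \<open>auto simp: c_def\<close>)
      show "at (0::real) within {0..1} \<noteq> bot"
        by (simp add: at_within_Icc_at_right trivial_limit_at_right_real)
    qed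
    then show "(p z - p z') \<bullet> (y - z') \<le> f \<bullet> (y - z')"
      by (simp add: algebra_simps inner_add_left inner_diff_left)
  qed fact
qed

text \<open>An explicit Euler scheme in the dual variable \<open>p z\<close>. Testing the step with \<open>y = z\<close>, strong
  monotonicity of \<open>p\<close> bounds its length by \<open>G / \<sigma> * h\<close>. The vector \<open>f\<close> is chosen at \<open>z\<close> whereas the
  step inequality refers to \<open>z'\<close>; replacing one by the other costs \<open>norm f * norm (z' - z)\<close>, whence
  the error term of first order in \<open>h\<close>.\<close>

lemma euler_sequence:
  fixes Z :: "'a::euclidean_space set"
  assumes Z: "compact Z" "convex Z" "z0 \<in> Z"
    and R: "\<And>z. z \<in> Z \<Longrightarrow> (R has_derivative (\<lambda>v. p z \<bullet> v)) (at z within Z)"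
    and mono: "\<And>z z'. z \<in> Z \<Longrightarrow> z' \<in> Z \<Longrightarrow> \<sigma> * (norm (z' - z))\<^sup>2 \<le> (p z' - p z) \<bullet> (z' - z)"
    and \<sigma>: "\<sigma> > 0"
    and sel: "\<And>z. z \<in> Z \<Longrightarrow> \<exists>f. norm f \<le> G \<and> (\<forall>y\<in>Z. f \<bullet> (y - z) \<le> \<Phi> z y)"
    and h: "h > 0"
  obtains \<zeta> :: "nat \<Rightarrow> 'a" where "\<zeta> 0 = z0" "\<And>k. \<zeta> k \<in> Z"
    "\<And>k. norm (\<zeta> (Suc k) - \<zeta> k) \<le> G / \<sigma> * h"
    "\<And>k y. y \<in> Z \<Longrightarrow>
      (p (\<zeta> k) - p (\<zeta> (Suc k))) \<bullet> (y - \<zeta> (Suc k)) \<le> h * (\<Phi> (\<zeta> k) y + G * (G / \<sigma> * h))"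
proof -
  have step: "\<exists>z'. z' \<in> Z \<and> norm (z' - z) \<le> G / \<sigma> * h \<and>
      (\<forall>y\<in>Z. (p z - p z') \<bullet> (y - z') \<le> h * (\<Phi> z y + G * (G / \<sigma> * h)))" if z: "z \<in> Z" for z
  proof -
    obtain f where f: "norm f \<le> G" "\<And>y. y \<in> Z \<Longrightarrow> f \<bullet> (y - z) \<le> \<Phi> z y"
      using sel[OF z] by blast
    obtain z' where z': "z' \<in> Z" "\<And>y. y \<in> Z \<Longrightarrow> (p z - p z') \<bullet> (y - z') \<le> (h *\<^sub>R f) \<bullet> (y - z')"
      using mirror_step[OF Z(1,2) R z, where f="h *\<^sub>R f"] by blast
    have "\<sigma> * (norm (z' - z))\<^sup>2 \<le> (p z' - p z) \<bullet> (z' - z)" by (rule mono[OF z z'(1)])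
    also have "\<dots> = (p z - p z') \<bullet> (z - z')" by (simp add: algebra_simps inner_diff_left inner_diff_right)
    also have "\<dots> \<le> (h *\<^sub>R f) \<bullet> (z - z')" by (rule z'(2)[OF z])
    also have "\<dots> \<le> h * (norm f * norm (z - z'))"
      using norm_cauchy_schwarz[of f "z - z'"] h by simp
    also have "\<dots> \<le> h * (G * norm (z' - z))"
      using f(1) h by (simp add: norm_minus_commute mult_left_mono mult_right_mono)
    finally have "norm (z' - z) * (\<sigma> * norm (z' - z)) \<le> norm (z' - z) * (h * G)"
      by (simp add: power2_eq_square algebra_simps)
    moreover have "0 \<le> h * G" using f(1) h norm_ge_zero[of f] by (simp del: norm_ge_zero)
    ultimately have "\<sigma> * norm (z' - z) \<le> h * G"
      by (cases "norm (z' - z) = 0") (auto simp: mult_le_cancel_left)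
    then have close: "norm (z' - z) \<le> G / \<sigma> * h" using \<sigma> by (simp add: field_simps)
    have "(p z - p z') \<bullet> (y - z') \<le> h * (\<Phi> z y + G * (G / \<sigma> * h))" if y: "y \<in> Z" for y
    proof -
      have "f \<bullet> (z - z') \<le> norm f * norm (z' - z)"
        using norm_cauchy_schwarz[of f "z - z'"] by (simp add: norm_minus_commute)
      also have "\<dots> \<le> G * (G / \<sigma> * h)"
        using close f(1) by (intro mult_mono) (auto intro: order_trans[OF norm_ge_zero])
      finally have "f \<bullet> (y - z') \<le> \<Phi> z y + G * (G / \<sigma> * h)"
        using f(2)[OF y] by (simp add: inner_diff_right)
      then have "h * (f \<bullet> (y - z')) \<le> h * (\<Phi> z y + G * (G / \<sigma> * h))"
        using h by (simp add: mult_left_mono)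
      then show ?thesis using z'(2)[OF y] by simp
    qed
    then show ?thesis using close z'(1) by blast
  qed
  define nxt where "nxt z = (SOME z'. z' \<in> Z \<and> norm (z' - z) \<le> G / \<sigma> * h \<and>
      (\<forall>y\<in>Z. (p z - p z') \<bullet> (y - z') \<le> h * (\<Phi> z y + G * (G / \<sigma> * h))))" for z
  have nxt: "nxt z \<in> Z" "norm (nxt z - z) \<le> G / \<sigma> * h"
      "\<And>y. y \<in> Z \<Longrightarrow> (p z - p (nxt z)) \<bullet> (y - nxt z) \<le> h * (\<Phi> z y + G * (G / \<sigma> * h))" if "z \<in> Z" for z
    using someI_ex[OF step[OF that]] unfolding nxt_def[of z, symmetric] by auto
  have inZ: "(nxt ^^ k) z0 \<in> Z" for k
    by (induction k) (use Z(3) nxt(1) in auto)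
  show thesis
    by (rule that[of "\<lambda>k. (nxt ^^ k) z0"]) (use inZ nxt in auto)
qed

lemma norm_diff_le_of_steps:
  fixes \<zeta> :: "nat \<Rightarrow> 'a::real_normed_vector"
  assumes "\<And>k. norm (\<zeta> (Suc k) - \<zeta> k) \<le> c" and "i \<le> j"
  shows "norm (\<zeta> j - \<zeta> i) \<le> c * real (j - i)"
  using \<open>i \<le> j\<close>
proof (induction j rule: dec_induct)
  case (step n)
  have "norm (\<zeta> (Suc n) - \<zeta> i) \<le> norm (\<zeta> (Suc n) - \<zeta> n) + norm (\<zeta> n - \<zeta> i)"
    using norm_triangle_ineq[of "\<zeta> (Suc n) - \<zeta> n" "\<zeta> n - \<zeta> i"] by simp
  then show ?case using assms(1)[of n] step by (simp add: Suc_diff_le algebra_simps)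
qed simp

text \<open>Summing the step inequalities along a stretch of the sequence near \<open>z\<close>, with the moving base
  points replaced by \<open>z\<close>. Because they are linear in the dual increments, the averaged increments
  again satisfy the variational inequality; this is why the limit of the scheme
  can be taken without weak limits of the chosen subgradients.\<close>

lemma variational_inequality_telescope:
  fixes \<zeta> :: "nat \<Rightarrow> 'a::real_inner"
  assumes step: "\<And>k. i \<le> k \<Longrightarrow> k < j \<Longrightarrow>
      (p (\<zeta> k) - p (\<zeta> (Suc k))) \<bullet> (y - \<zeta> (Suc k)) \<le> b"
    and M: "\<And>k. norm (p (\<zeta> k) - p (\<zeta> (Suc k))) \<le> M"
    and close: "\<And>k. i \<le> k \<Longrightarrow> k \<le> j \<Longrightarrow> norm (\<zeta> k - z) \<le> \<rho>"
    and "i \<le> j"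
  shows "(p (\<zeta> i) - p (\<zeta> j)) \<bullet> (y - z) \<le> real (j - i) * (b + M * \<rho>)"
  using \<open>i \<le> j\<close> step close
proof (induction j rule: dec_induct)
  case (step n)
  have IH: "(p (\<zeta> i) - p (\<zeta> n)) \<bullet> (y - z) \<le> real (n - i) * (b + M * \<rho>)"
    using step by simp
  have "(p (\<zeta> n) - p (\<zeta> (Suc n))) \<bullet> (\<zeta> (Suc n) - z) \<le>
      norm (p (\<zeta> n) - p (\<zeta> (Suc n))) * norm (\<zeta> (Suc n) - z)"
    by (rule norm_cauchy_schwarz)
  also have "\<dots> \<le> M * \<rho>"
    using M[of n] step by (intro mult_mono) (auto intro: order_trans[OF norm_ge_zero])
  moreover have "(p (\<zeta> n) - p (\<zeta> (Suc n))) \<bullet> (y - \<zeta> (Suc n)) \<le> b"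
    using step by simp
  ultimately have "(p (\<zeta> n) - p (\<zeta> (Suc n))) \<bullet> (y - z) \<le> b + M * \<rho>"
    by (simp add: inner_diff_right)
  then show ?case using IH step.hyps by (simp add: Suc_diff_le algebra_simps inner_diff_left)
qed simp

text \<open>Tychonoff's theorem in place of the Arzela-Ascoli theorem: a cluster point of the sequence in
  the product topology becomes an honest pointwise limit along a filter finer than \<open>sequentially\<close>.
  Pointwise limits suffice below, because the estimates on the approximate curves involve two times
  only, and no diagonal subsequence has to be extracted on the half-line.\<close>

lemma pointwise_cluster_filter:
  fixes w :: "nat \<Rightarrow> 'b \<Rightarrow> 'a::topological_space"
  assumes Z: "compact Z" and w: "\<And>n t. w n t \<in> Z"
  obtains F z where "F \<noteq> bot" "F \<le> sequentially" "\<And>t. z t \<in> Z" "\<And>t. ((\<lambda>n. w n t) \<longlongrightarrow> z t) F"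
proof -
  have "compactin (product_topology (\<lambda>_::'b. euclidean :: 'a topology) UNIV) (PiE UNIV (\<lambda>_. Z))"
    unfolding compactin_PiE using Z by simp
  then have "compact (PiE (UNIV::'b set) (\<lambda>_. Z))"
    by (simp add: euclidean_product_topology)
  moreover have "filtermap w sequentially \<noteq> bot" by (simp add: filtermap_bot_iff)
  moreover have "eventually (\<lambda>f. f \<in> PiE UNIV (\<lambda>_. Z)) (filtermap w sequentially)"
    using w by (simp add: eventually_filtermap PiE_UNIV_domain)
  ultimately obtain z where z: "z \<in> PiE UNIV (\<lambda>_. Z)" "inf (nhds z) (filtermap w sequentially) \<noteq> bot"
    unfolding compact_filter by blast
  define F where "F = inf sequentially (filtercomap w (nhds z))"
  have "F \<noteq> bot"
  proof
    assume "F = bot"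
    then have "eventually (\<lambda>n. False) F" by simp
    then obtain P Q where PQ: "eventually P sequentially" "eventually Q (filtercomap w (nhds z))"
        "\<And>n. P n \<Longrightarrow> Q n \<Longrightarrow> False"
      unfolding F_def eventually_inf by auto
    obtain Q' where Q': "eventually Q' (nhds z)" "\<And>n. Q' (w n) \<Longrightarrow> Q n"
      using PQ(2) unfolding eventually_filtercomap by auto
    have "eventually (\<lambda>f. \<not> Q' f) (filtermap w sequentially)"
      unfolding eventually_filtermap using PQ(1) by eventually_elim (use PQ(3) Q'(2) in blast)
    then have "eventually (\<lambda>f. False) (inf (nhds z) (filtermap w sequentially))"
      unfolding eventually_inf using Q'(1) by blast
    then show False using z(2) by simp
  qed
  moreover have "F \<le> sequentially" by (simp add: F_def)
  moreover have "((\<lambda>n. w n t) \<longlongrightarrow> z t) F" for t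
  proof (rule topological_tendstoI)
    fix S :: "'a set" assume S: "open S" "z t \<in> S"
    have "open ((\<lambda>f :: 'b \<Rightarrow> 'a. f t) -` S)"
      by (rule open_vimage[OF S(1) continuous_on_product_coordinates])
    then have "\<forall>\<^sub>F f in nhds z. f \<in> (\<lambda>f. f t) -` S"
      by (rule eventually_nhds_in_open) (use S(2) in simp)
    then have "\<forall>\<^sub>F f in nhds z. f t \<in> S" by simp
    then have "\<forall>\<^sub>F n in filtercomap w (nhds z). w n t \<in> S" by (rule eventually_filtercomapI)
    then show "\<forall>\<^sub>F n in F. w n t \<in> S" unfolding F_def using filter_leD inf_le2 by blast
  qed
  moreover have "z t \<in> Z" for t using z(1) by auto
  ultimately show thesis using that by blast
qed

text \<open>The continuous-time limit of the Euler scheme. Read \<open>A z = {w. \<forall>y\<in>Z. w \<bullet> (y - z) \<le> \<Phi> z y}\<close> as a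
  set-valued operator: the hypothesis \<open>sel\<close> says that \<open>A\<close> has bounded selections, and the conclusion is
  an integrated form of the inclusion \<open>- (p \<circ> z)' \<in> A z\<close> that makes sense before any
  differentiability is known. Over the short interval from \<open>t\<close> to \<open>s\<close> the approximate curves stay
  near \<open>z t\<close>, so there the bifunction can be frozen at \<open>z t\<close> up to \<open>\<epsilon>\<close>, by continuity of
  \<open>\<lambda>z. \<Phi> z y\<close>.\<close>

theorem mirror_flow_existence:
  fixes Z :: "'a::euclidean_space set"
  assumes Z: "compact Z" "convex Z" "z0 \<in> Z"
    and R: "\<And>z. z \<in> Z \<Longrightarrow> (R has_derivative (\<lambda>v. p z \<bullet> v)) (at z within Z)"
    and mono: "\<And>z z'. z \<in> Z \<Longrightarrow> z' \<in> Z \<Longrightarrow> \<sigma> * (norm (z' - z))\<^sup>2 \<le> (p z' - p z) \<bullet> (z' - z)"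
    and \<sigma>: "\<sigma> > 0"
    and lip: "\<Lambda>-lipschitz_on Z p"
    and sel: "\<And>z. z \<in> Z \<Longrightarrow> \<exists>f. norm f \<le> G \<and> (\<forall>y\<in>Z. f \<bullet> (y - z) \<le> \<Phi> z y)"
    and \<Phi>: "\<And>y. y \<in> Z \<Longrightarrow> continuous_on Z (\<lambda>z. \<Phi> z y)"
  obtains z :: "real \<Rightarrow> 'a" where "z 0 = z0" "\<And>t. z t \<in> Z" "(G / \<sigma>)-lipschitz_on UNIV z"
    "\<And>t y \<epsilon>. 0 \<le> t \<Longrightarrow> y \<in> Z \<Longrightarrow> 0 < \<epsilon> \<Longrightarrow>
      \<forall>\<^sub>F s in at_right t. (p (z t) - p (z s)) \<bullet> (y - z t) \<le> (s - t) * (\<Phi> (z t) y + \<epsilon>)"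
proof -
  define K where "K = G / \<sigma>"
  have G0: "G \<ge> 0" using sel[OF Z(3)] norm_ge_zero order_trans by blast
  have K0: "K \<ge> 0" using G0 \<sigma> by (simp add: K_def)
  have \<Lambda>0: "\<Lambda> \<ge> 0" using lip lipschitz_on_nonneg by blast
  define h where "h n = 1 / real (Suc n)" for n
  have h0: "h n > 0" for n by (simp add: h_def)
  have "\<exists>\<zeta>. \<forall>n. \<zeta> n 0 = z0 \<and> (\<forall>k. \<zeta> n k \<in> Z) \<and>
    (\<forall>k. norm (\<zeta> n (Suc k) - \<zeta> n k) \<le> K * h n) \<and>
    (\<forall>k y. y \<in> Z \<longrightarrow>
      (p (\<zeta> n k) - p (\<zeta> n (Suc k))) \<bullet> (y - \<zeta> n (Suc k)) \<le> h n * (\<Phi> (\<zeta> n k) y + G * (K * h n)))"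
    by (rule choice, intro allI, rule euler_sequence[OF Z R mono \<sigma> sel h0]) (auto simp: K_def)
  then obtain \<zeta> where \<zeta>0: "\<And>n. \<zeta> n 0 = z0" and \<zeta>Z: "\<And>n k. \<zeta> n k \<in> Z"
    and \<zeta>step: "\<And>n k. norm (\<zeta> n (Suc k) - \<zeta> n k) \<le> K * h n"
    and \<zeta>VI: "\<And>n k y. y \<in> Z \<Longrightarrow>
      (p (\<zeta> n k) - p (\<zeta> n (Suc k))) \<bullet> (y - \<zeta> n (Suc k)) \<le> h n * (\<Phi> (\<zeta> n k) y + G * (K * h n))"
    by blast
  define ix where "ix n t = nat \<lfloor>t / h n\<rfloor>" for n and t :: real
  \<comment> \<open>A step function; its increments obey a Lipschitz bound up to the mesh size \<open>h n\<close>.\<close>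
  define w where "w n t = \<zeta> n (ix n t)" for n t
  have ix_mono: "ix n s \<le> ix n t" if "s \<le> t" for n s t
    unfolding ix_def using that h0[of n] by (intro nat_mono floor_mono divide_right_mono) auto
  have ix_diff: "\<bar>h n * real (ix n t - ix n s) - (t - s)\<bar> \<le> h n" if "0 \<le> s" "s \<le> t" for n s t
  proof -
    have r: "real (ix n u) = of_int \<lfloor>u / h n\<rfloor>" if "0 \<le> u" for u
      using that h0[of n] by (simp add: ix_def)
    have "\<bar>(real (ix n t) - real (ix n s)) - (t / h n - s / h n)\<bar> \<le> 1"
      using r[of s] r[of t] that by linarith
    then have "h n * \<bar>(real (ix n t) - real (ix n s)) - (t / h n - s / h n)\<bar> \<le> h n * 1"
      using h0[of n] by (intro mult_left_mono) auto
    moreover have "h n * \<bar>(real (ix n t) - real (ix n s)) - (t / h n - s / h n)\<bar> =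
        \<bar>h n * ((real (ix n t) - real (ix n s)) - (t / h n - s / h n))\<bar>"
      using h0[of n] by (simp add: abs_mult)
    moreover have "h n * ((real (ix n t) - real (ix n s)) - (t / h n - s / h n)) =
        h n * real (ix n t - ix n s) - (t - s)"
      using h0[of n] ix_mono[OF that(2), of n] by (simp add: field_simps of_nat_diff)
    ultimately show ?thesis by simp
  qed
  have \<zeta>dist: "norm (\<zeta> n j - \<zeta> n i) \<le> K * h n * real (j - i)" if "i \<le> j" for n i j
    by (rule norm_diff_le_of_steps[of "\<zeta> n"]) (use \<zeta>step that in auto)
  have wdist: "norm (w n t - w n s) \<le> K * (t - s + h n)" if "0 \<le> s" "s \<le> t" for n s t
  proof -
    have "norm (w n t - w n s) \<le> K * (h n * real (ix n t - ix n s))"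
      using \<zeta>dist[OF ix_mono[OF that(2)]] by (simp add: w_def mult.assoc)
    also have "\<dots> \<le> K * (t - s + h n)"
      using ix_diff[OF that, of n] K0 by (intro mult_left_mono) auto
    finally show ?thesis .
  qed
  obtain F zz where F: "F \<noteq> bot" "F \<le> sequentially" "\<And>t. zz t \<in> Z" "\<And>t. ((\<lambda>n. w n t) \<longlongrightarrow> zz t) F"
    using pointwise_cluster_filter[OF Z(1), of w] \<zeta>Z unfolding w_def by blast
  have hlim: "(h \<longlongrightarrow> 0) F"
    using tendsto_mono[OF F(2) LIMSEQ_inverse_real_of_nat] by (simp add: h_def[abs_def] inverse_eq_divide)
  \<comment> \<open>Freezing the curve at negative times makes it Lipschitz on the whole line.\<close>
  define z where "z t = zz (max 0 t)" for t
  have z_w: "((\<lambda>n. w n t) \<longlongrightarrow> z t) F" if "0 \<le> t" for t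
    using F(4)[of t] that by (simp add: z_def)
  have z_lip: "norm (z t - z s) \<le> K * (t - s)" if "0 \<le> s" "s \<le> t" for s t
  proof (rule tendsto_le[OF F(1)])
    show "((\<lambda>n. norm (w n t - w n s)) \<longlongrightarrow> norm (z t - z s)) F"
      using that by (intro tendsto_intros z_w) auto
    have "((\<lambda>n. K * (t - s + h n)) \<longlongrightarrow> K * (t - s + 0)) F"
      by (intro tendsto_intros hlim)
    then show "((\<lambda>n. K * (t - s + h n)) \<longlongrightarrow> K * (t - s)) F" by simp
  qed (use wdist[OF that] in simp)
  have zdist: "dist (z t) (z s) \<le> K * \<bar>t - s\<bar>" for s t
  proof (induction s t rule: linorder_wlog)
    case (le s t)
    have "dist (z t) (z s) \<le> K * (max 0 t - max 0 s)"
      using z_lip[of "max 0 s" "max 0 t"] le by (simp add: z_def dist_norm)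
    also have "\<dots> \<le> K * \<bar>t - s\<bar>" using K0 le by (intro mult_left_mono) auto
    finally show ?case .
  qed (simp add: dist_commute abs_minus_commute)
  have zZ: "z t \<in> Z" for t using F(3) by (simp add: z_def)
  show thesis
  proof
    show "z 0 = z0"
    proof (rule tendsto_unique[OF F(1) z_w])
      show "((\<lambda>n. w n 0) \<longlongrightarrow> z0) F" using \<zeta>0 by (simp add: w_def ix_def)
    qed simp
    show "(G / \<sigma>)-lipschitz_on UNIV z"
      using zdist K0 by (intro lipschitz_onI) (auto simp: K_def dist_real_def)
    show "z t \<in> Z" for t by (rule zZ)
    fix t \<epsilon> :: real and y :: 'a
    assume t: "0 \<le> t" and y: "y \<in> Z" and \<epsilon>: "0 < \<epsilon>"
    define M where "M = \<Lambda> * K"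
    have M0: "M \<ge> 0" using \<Lambda>0 K0 by (simp add: M_def)
    obtain \<rho>0 where \<rho>0: "\<rho>0 > 0" "\<And>x. x \<in> Z \<Longrightarrow> norm (x - z t) < \<rho>0 \<Longrightarrow> \<bar>\<Phi> x y - \<Phi> (z t) y\<bar> < \<epsilon> / 2"
      using \<Phi>[OF y] zZ[of t] \<epsilon> unfolding continuous_on_iff dist_norm real_norm_def
      by (metis half_gt_zero)
    \<comment> \<open>The first bound controls the variation of \<open>\<Phi>\<close>, the second the dual error \<open>M * \<rho>\<close>;
      the denominator is \<open>M + 1\<close> because \<open>M\<close> may vanish.\<close>
    define \<rho> where "\<rho> = min (\<rho>0 / 2) (\<epsilon> / 2 / (M + 1))"
    have \<rho>: "\<rho> > 0" using \<rho>0(1) \<epsilon> M0 by (simp add: \<rho>_def)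
    have \<rho>_less: "\<rho> < \<rho>0" using \<rho>0(1) by (simp add: \<rho>_def min_less_iff_disj)
    have "M * \<rho> \<le> (M + 1) * (\<epsilon> / 2 / (M + 1))"
      using M0 \<rho> \<epsilon> by (intro mult_mono) (auto simp: \<rho>_def)
    also have "\<dots> = \<epsilon> / 2" using M0 by (simp add: field_simps)
    finally have M\<rho>: "M * \<rho> \<le> \<epsilon> / 2" .
    have main: "(p (z t) - p (z s)) \<bullet> (y - z t) \<le> (s - t) * (\<Phi> (z t) y + \<epsilon> / 2 + M * \<rho>)"
      if s: "t < s" "K * (s - t) < \<rho> / 2" for s
    proof (rule tendsto_le[OF F(1)])
      have plim: "((\<lambda>n. p (w n u)) \<longlongrightarrow> p (z u)) F" if "0 \<le> u" for u
      proof (rule continuous_on_tendsto_compose[OF lipschitz_on_continuous_on[OF lip] z_w[OF that] zZ])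
        show "\<forall>\<^sub>F n in F. w n u \<in> Z" using \<zeta>Z by (simp add: w_def)
      qed
      show "((\<lambda>n. (p (w n t) - p (w n s)) \<bullet> (y - z t)) \<longlongrightarrow> (p (z t) - p (z s)) \<bullet> (y - z t)) F"
        using t s by (intro tendsto_intros plim) auto
      let ?b = "\<lambda>n. \<Phi> (z t) y + \<epsilon> / 2 + G * (K * h n)"
      have step_lim: "((\<lambda>n. h n * real (ix n s - ix n t)) \<longlongrightarrow> s - t) F"
      proof (rule Lim_transform[OF tendsto_const])
        show "((\<lambda>n. h n * real (ix n s - ix n t) - (s - t)) \<longlongrightarrow> 0) F"
        proof (rule Lim_null_comparison[OF _ hlim])
          show "\<forall>\<^sub>F n in F. norm (h n * real (ix n s - ix n t) - (s - t)) \<le> h n"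
            using ix_diff[OF t less_imp_le[OF s(1)]] by simp
        qed
      qed
      have "((\<lambda>n. h n * real (ix n s - ix n t) * (?b n + M * \<rho>)) \<longlongrightarrow>
          (s - t) * (\<Phi> (z t) y + \<epsilon> / 2 + G * (K * 0) + M * \<rho>)) F"
        by (intro tendsto_intros step_lim hlim)
      then show "((\<lambda>n. h n * real (ix n s - ix n t) * (?b n + M * \<rho>)) \<longlongrightarrow>
          (s - t) * (\<Phi> (z t) y + \<epsilon> / 2 + M * \<rho>)) F" by simp
      have ev1: "\<forall>\<^sub>F n in F. norm (w n t - z t) < \<rho> / 4"
        using tendstoD[OF z_w[OF t], of "\<rho> / 4"] \<rho> by (simp add: dist_norm)
      have "((\<lambda>n. K * h n) \<longlongrightarrow> K * 0) F" by (intro tendsto_intros hlim)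
      then have "((\<lambda>n. K * h n) \<longlongrightarrow> 0) F" by simp
      then have ev2: "\<forall>\<^sub>F n in F. K * h n < \<rho> / 4"
        by (rule order_tendstoD(2)) (use \<rho> in simp)
      show "\<forall>\<^sub>F n in F. (p (w n t) - p (w n s)) \<bullet> (y - z t) \<le>
          h n * real (ix n s - ix n t) * (?b n + M * \<rho>)"
        using ev1 ev2
      proof eventually_elim
        case (elim n)
        have close: "norm (\<zeta> n k - z t) \<le> \<rho>" if k: "ix n t \<le> k" "k \<le> ix n s" for k
        proof -
          have "norm (\<zeta> n k - w n t) \<le> K * h n * real (k - ix n t)"
            using \<zeta>dist[OF k(1)] by (simp add: w_def)
          also have "\<dots> \<le> K * h n * real (ix n s - ix n t)"
            using k K0 h0[of n] by (intro mult_left_mono) auto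
          also have "\<dots> \<le> K * (s - t + h n)"
            using ix_diff[OF t less_imp_le[OF s(1)], of n] K0
            unfolding mult.assoc by (intro mult_left_mono) auto
          also have "\<dots> \<le> \<rho> / 2 + \<rho> / 4" using s(2) elim by (simp add: algebra_simps)
          finally show ?thesis
            using elim norm_triangle_ineq[of "\<zeta> n k - w n t" "w n t - z t"] by simp
        qed
        have "(p (\<zeta> n (ix n t)) - p (\<zeta> n (ix n s))) \<bullet> (y - z t) \<le>
            real (ix n s - ix n t) * (h n * ?b n + M * h n * \<rho>)"
        proof (rule variational_inequality_telescope[where \<zeta> = "\<zeta> n" and p = p])
          show "ix n t \<le> ix n s" using s ix_mono by simp
          show "norm (p (\<zeta> n k) - p (\<zeta> n (Suc k))) \<le> M * h n" for k
          proof -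
            have "norm (p (\<zeta> n k) - p (\<zeta> n (Suc k))) \<le> \<Lambda> * norm (\<zeta> n (Suc k) - \<zeta> n k)"
              using lipschitz_onD[OF lip \<zeta>Z \<zeta>Z] by (metis dist_norm norm_minus_commute)
            also have "\<dots> \<le> \<Lambda> * (K * h n)" using \<zeta>step \<Lambda>0 by (intro mult_left_mono)
            finally show ?thesis by (simp add: M_def mult.assoc)
          qed
          fix k assume k: "ix n t \<le> k" "k \<le> ix n s"
          show "norm (\<zeta> n k - z t) \<le> \<rho>" by (rule close[OF k])
        next
          fix k assume k: "ix n t \<le> k" "k < ix n s"
          have "norm (\<zeta> n k - z t) < \<rho>0" using close[of k] k \<rho>_less by simp
          then have "\<Phi> (\<zeta> n k) y \<le> \<Phi> (z t) y + \<epsilon> / 2"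
            using \<rho>0(2)[OF \<zeta>Z, of n k] by linarith
          then have "h n * (\<Phi> (\<zeta> n k) y + G * (K * h n)) \<le> h n * ?b n"
            using h0[of n] by (intro mult_left_mono) auto
          then show "(p (\<zeta> n k) - p (\<zeta> n (Suc k))) \<bullet> (y - \<zeta> n (Suc k)) \<le> h n * ?b n"
            using \<zeta>VI[OF y, of n k] by linarith
        qed
        then show ?case by (simp add: w_def algebra_simps)
      qed
    qed
    have "\<forall>\<^sub>F s in at_right t. K * (s - t) < \<rho> / 2"
    proof (rule order_tendstoD(2))
      have "((\<lambda>s. K * (s - t)) \<longlongrightarrow> K * (t - t)) (at_right t)" by (intro tendsto_intros)
      then show "((\<lambda>s. K * (s - t)) \<longlongrightarrow> 0) (at_right t)" by simp
    qed (use \<rho> in simp)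
    moreover have "\<forall>\<^sub>F s in at_right t. t < s" by (rule eventually_at_right_less)
    ultimately show "\<forall>\<^sub>F s in at_right t. (p (z t) - p (z s)) \<bullet> (y - z t) \<le> (s - t) * (\<Phi> (z t) y + \<epsilon>)"
    proof eventually_elim
      case (elim s)
      have "(s - t) * (\<Phi> (z t) y + \<epsilon> / 2 + M * \<rho>) \<le> (s - t) * (\<Phi> (z t) y + \<epsilon>)"
        using M\<rho> elim by (intro mult_left_mono) auto
      then show ?case using main[OF elim(2,1)] by linarith
    qed
  qed
qed

section \<open>Subgradients and normal cones\<close>

text \<open>The variational description of the normal cone passes to limits of difference quotients.\<close>

lemma normal_coneI:
  assumes "\<And>y. y \<in> C \<Longrightarrow> \<eta> \<bullet> (y - x) \<le> 0"
  shows "\<eta> \<in> normal_cone C x"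
  unfolding normal_cone_def mem_Collect_eq
proof
  fix v assume "v \<in> tangent_cone C x"
  then obtain z t where zt: "\<And>k. z k \<in> C" "\<And>k. t k > (0::real)"
      "(\<lambda>k. (z k - x) /\<^sub>R t k) \<longlonglongrightarrow> v"
    unfolding tangent_cone_def by blast
  have "(\<lambda>k. \<eta> \<bullet> ((z k - x) /\<^sub>R t k)) \<longlonglongrightarrow> \<eta> \<bullet> v"
    by (intro tendsto_intros zt)
  then show "\<eta> \<bullet> v \<le> 0"
  proof (rule LIMSEQ_le_const2)
    have "\<eta> \<bullet> ((z k - x) /\<^sub>R t k) \<le> 0" for k
      using assms[OF zt(1)[of k]] zt(2)[of k] by (simp add: mult_nonneg_nonpos)
    then show "\<exists>N. \<forall>k\<ge>N. \<eta> \<bullet> ((z k - x) /\<^sub>R t k) \<le> 0" by blast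
  qed
qed

text \<open>At an infinite value the inequality that defines a subgradient does not depend on the
  subgradient, so one subgradient would make every vector a subgradient.\<close>

lemma finite_of_bounded_subdifferential:
  fixes f :: "'a::euclidean_space \<Rightarrow> ereal"
  assumes "subdifferential f x \<noteq> {}" "bounded (subdifferential f x)"
  shows "\<bar>f x\<bar> \<noteq> \<infinity>"
proof
  assume inf: "\<bar>f x\<bar> = \<infinity>"
  obtain g where g: "\<And>y. f x + ereal (g \<bullet> (y - x)) \<le> f y"
    using assms(1) unfolding subdifferential_def by auto
  have "g' \<in> subdifferential f x" for g'
    using inf g unfolding subdifferential_def by (cases "f x") auto
  then have "subdifferential f x = UNIV" by blast
  then show False using assms(2) not_bounded_UNIV by metis
qed

text \<open>The sum rule for \<open>f\<close> plus the indicator function of \<open>X\<close>: a subgradient relative to \<open>X\<close> is a genuine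
  subgradient plus a normal vector. Separate the epigraph of \<open>f\<close> from the part over \<open>X\<close> of the
  hypograph of the affine minorant with slope \<open>w\<close>. A non-vertical separating hyperplane is the
  graph of an affine minorant of \<open>f\<close>, which yields \<open>g\<close>. A vertical one would bound the effective
  domain of \<open>f\<close> by a hyperplane through \<open>x\<close>, and adding multiples of its normal to a subgradient
  would make the subdifferential unbounded. Boundedness of the subdifferential thus acts as the
  constraint qualification.\<close>

lemma restricted_subgradient_decomposition:
  fixes f :: "'a::euclidean_space \<Rightarrow> ereal"
  assumes f: "convex_ereal f" and X: "convex X" "x \<in> X"
    and sub: "subdifferential f x \<noteq> {}" "bounded (subdifferential f x)"
    and w: "\<And>y. y \<in> X \<Longrightarrow> f x + ereal (w \<bullet> (y - x)) \<le> f y"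
  obtains g \<eta> where "g \<in> subdifferential f x" "\<eta> \<in> normal_cone X x" "w = g + \<eta>"
proof -
  obtain a where a: "f x = ereal a"
    using finite_of_bounded_subdifferential[OF sub] by auto
  obtain g0 where g0: "g0 \<in> subdifferential f x" using sub by blast
  define S where "S = {(y, r). y \<in> X \<and> r < a + w \<bullet> (y - x)}"
  define T where "T = {(y, r). f y \<le> ereal r}"
  have "convex S"
    unfolding convex_def S_def
  proof (clarsimp, intro conjI)
    fix y1 y2 and r1 r2 u v :: real
    assume y: "y1 \<in> X" "y2 \<in> X" and r: "r1 < a + w \<bullet> (y1 - x)" "r2 < a + w \<bullet> (y2 - x)"
      and uv: "0 \<le> u" "0 \<le> v" "u + v = 1"
    show "u *\<^sub>R y1 + v *\<^sub>R y2 \<in> X" using convexD[OF X(1)] y uv by blast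
    have "u * r1 + v * r2 < u * (a + w \<bullet> (y1 - x)) + v * (a + w \<bullet> (y2 - x))"
    proof (cases "u = 0")
      case True
      then show ?thesis using uv r by simp
    next
      case False
      then have "u * r1 < u * (a + w \<bullet> (y1 - x))" using r uv by simp
      moreover have "v * r2 \<le> v * (a + w \<bullet> (y2 - x))" using r uv by (simp add: mult_left_mono)
      ultimately show ?thesis by linarith
    qed
    also have "\<dots> = (u + v) * (a - w \<bullet> x) + w \<bullet> (u *\<^sub>R y1 + v *\<^sub>R y2)"
      by (simp add: inner_diff_right inner_add_right algebra_simps)
    finally show "u * r1 + v * r2 < a + w \<bullet> (u *\<^sub>R y1 + v *\<^sub>R y2 - x)"
      using uv(3) by (simp add: inner_diff_right)
  qed
  moreover have "convex T" using f by (simp add: convex_ereal_def T_def)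
  moreover have "(x, a - 1) \<in> S" using X(2) by (simp add: S_def)
  moreover have Tx: "(x, a) \<in> T" by (simp add: T_def a)
  moreover have "S \<inter> T = {}"
  proof (rule ccontr)
    assume "S \<inter> T \<noteq> {}"
    then obtain y r where yr: "y \<in> X" "r < a + w \<bullet> (y - x)" "f y \<le> ereal r"
      by (auto simp: S_def T_def)
    have "ereal (a + w \<bullet> (y - x)) \<le> ereal r"
      using order_trans[OF w[OF yr(1)] yr(3)] by (simp add: a)
    then show False using yr(2) by simp
  qed
  ultimately obtain uc c where uc: "uc \<noteq> 0" "\<And>q. q \<in> S \<Longrightarrow> uc \<bullet> q \<le> c" "\<And>q. q \<in> T \<Longrightarrow> c \<le> uc \<bullet> q"
    using separating_hyperplane_sets[of S T] by (metis empty_iff)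
  obtain u \<beta> where ub: "uc = (u, \<beta>)" by (cases uc)
  have T: "c \<le> u \<bullet> y + \<beta> * r" if "f y \<le> ereal r" for y r
    using uc(3)[of "(y, r)"] that by (simp add: T_def ub)
  have S: "u \<bullet> y + \<beta> * (a + w \<bullet> (y - x)) \<le> c" if y: "y \<in> X" for y
  proof (rule tendsto_upperbound)
    have "((\<lambda>e. u \<bullet> y + \<beta> * (a + w \<bullet> (y - x) - e)) \<longlongrightarrow> u \<bullet> y + \<beta> * (a + w \<bullet> (y - x) - 0)) (at_right 0)"
      by (intro tendsto_intros)
    then show "((\<lambda>e. u \<bullet> y + \<beta> * (a + w \<bullet> (y - x) - e)) \<longlongrightarrow> u \<bullet> y + \<beta> * (a + w \<bullet> (y - x))) (at_right 0)"
      by simp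
    show "\<forall>\<^sub>F e in at_right 0. u \<bullet> y + \<beta> * (a + w \<bullet> (y - x) - e) \<le> c"
      using eventually_at_right_less[of 0]
    proof eventually_elim
      case (elim e)
      then have "(y, a + w \<bullet> (y - x) - e) \<in> S" using y by (simp add: S_def)
      then show ?case using uc(2) by (fastforce simp: ub)
    qed
  qed simp
  have c: "c = u \<bullet> x + \<beta> * a" using T[of x a] S[OF X(2)] by (simp add: a)
  have "\<beta> \<ge> 0" using T[of x "a + 1"] c by (simp add: a algebra_simps)
  have "\<beta> \<noteq> 0"
  proof
    assume \<beta>: "\<beta> = 0"
    then have u: "u \<noteq> 0" using uc(1) ub by (simp add: zero_prod_def)
    have ray: "g0 - s *\<^sub>R u \<in> subdifferential f x" if s: "0 \<le> s" for s
      unfolding subdifferential_def mem_Collect_eq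
    proof
      fix y
      have g0y: "f x + ereal (g0 \<bullet> (y - x)) \<le> f y" using g0 by (simp add: subdifferential_def)
      show "f x + ereal ((g0 - s *\<^sub>R u) \<bullet> (y - x)) \<le> f y"
      proof (cases "f y = \<infinity>")
        case False
        then obtain r where "f y \<le> ereal r" by (cases "f y") auto
        then have "0 \<le> u \<bullet> (y - x)" using T[of y r] c \<beta> by (simp add: inner_diff_right)
        then have "(g0 - s *\<^sub>R u) \<bullet> (y - x) \<le> g0 \<bullet> (y - x)"
          using s by (simp add: inner_diff_left)
        then have "f x + ereal ((g0 - s *\<^sub>R u) \<bullet> (y - x)) \<le> f x + ereal (g0 \<bullet> (y - x))"
          by (simp add: a)
        then show ?thesis using g0y by (rule order_trans)
      qed simp
    qed
    obtain G where G: "\<And>g. g \<in> subdifferential f x \<Longrightarrow> norm g \<le> G"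
      using sub(2) by (auto simp: bounded_iff)
    \<comment> \<open>Long enough for the point of the ray at \<open>s\<close> to have norm greater than \<open>G\<close>.\<close>
    define s where "s = (G + norm g0 + 1) / norm u"
    have Gpos: "0 \<le> G" using G[OF g0] norm_ge_zero order_trans by blast
    have s: "0 \<le> s" "s * norm u = G + norm g0 + 1" using u Gpos by (auto simp: s_def)
    have "s * norm u \<le> norm g0 + norm (g0 - s *\<^sub>R u)"
      using norm_triangle_ineq4[of g0 "g0 - s *\<^sub>R u"] s(1) by simp
    then show False using G[OF ray[OF s(1)]] s(2) by linarith
  qed
  then have \<beta>: "\<beta> > 0" using \<open>\<beta> \<ge> 0\<close> by simp
  define g where "g = - (u /\<^sub>R \<beta>)"
  have \<beta>g: "\<beta> * (g \<bullet> v) = - (u \<bullet> v)" for v using \<beta> by (simp add: g_def)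
  show thesis
  proof
    have low: "a + g \<bullet> (y - x) \<le> r" if "f y \<le> ereal r" for y r
    proof -
      have "\<beta> * (a + g \<bullet> (y - x)) \<le> \<beta> * r"
        using T[OF that] c \<beta>g[of "y - x"] by (simp add: algebra_simps inner_diff_right)
      then show ?thesis using \<beta> by simp
    qed
    show "g \<in> subdifferential f x"
      unfolding subdifferential_def mem_Collect_eq
    proof
      fix y
      show "f x + ereal (g \<bullet> (y - x)) \<le> f y"
      proof (cases "f y")
        case MInf
        then have False using low[of y "a + g \<bullet> (y - x) - 1"] by simp
        then show ?thesis ..
      qed (use low[of y] in \<open>auto simp: a\<close>)
    qed
    show "w - g \<in> normal_cone X x"
    proof (rule normal_coneI)
      fix y assume "y \<in> X"
      have "\<beta> * ((w - g) \<bullet> (y - x)) = u \<bullet> y + \<beta> * (a + w \<bullet> (y - x)) - c"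
        using \<beta>g[of "y - x"] by (simp add: c inner_diff_left inner_diff_right algebra_simps)
      also have "\<dots> \<le> 0" using S[OF \<open>y \<in> X\<close>] by simp
      finally show "(w - g) \<bullet> (y - x) \<le> 0" using \<beta> by (simp add: mult_le_0_iff)
    qed
  qed simp
qed

lemma convex_ereal_uminus:
  assumes "concave_ereal f"
  shows "convex_ereal (\<lambda>x. - f x)"
proof -
  have "{(x, r). - f x \<le> ereal r} = (\<lambda>(x, r). (x, - r)) ` {(x, r). ereal r \<le> f x}"
  proof (intro set_eqI iffI)
    fix q assume "q \<in> {(x, r). - f x \<le> ereal r}"
    then obtain x r where q: "q = (x, r)" "- f x \<le> ereal r" by auto
    have "ereal (- r) \<le> f x" using q(2) by (metis ereal_minus_le_minus ereal_uminus_uminus uminus_ereal.simps(1))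
    then show "q \<in> (\<lambda>(x, r). (x, - r)) ` {(x, r). ereal r \<le> f x}"
      unfolding q by (intro image_eqI[of _ _ "(x, - r)"]) auto
  next
    fix q assume "q \<in> (\<lambda>(x, r). (x, - r)) ` {(x, r). ereal r \<le> f x}"
    then obtain x r where q: "q = (x, - r)" "ereal r \<le> f x" by auto
    then show "q \<in> {(x, r). - f x \<le> ereal r}"
      by (metis (no_types, lifting) case_prodI ereal_minus_le_minus mem_Collect_eq uminus_ereal.simps(1))
  qed
  moreover have "linear (\<lambda>(x :: 'a, r :: real). (x, - r))"
    by (rule linearI) auto
  ultimately show ?thesis
    using assms convex_linear_image unfolding convex_ereal_def concave_ereal_def by metis
qed

lemma subdifferential_uminus:
  "subdifferential (\<lambda>x. - f x) x = uminus ` superdifferential f x"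
proof -
  have *: "- f x + ereal (g \<bullet> v) \<le> - f y \<longleftrightarrow> f y \<le> f x + ereal (- g \<bullet> v)" for g v y
    by (cases "f x"; cases "f y") auto
  show ?thesis
  proof (intro set_eqI iffI)
    fix g assume "g \<in> subdifferential (\<lambda>x. - f x) x"
    then have "- g \<in> superdifferential f x"
      by (simp add: subdifferential_def superdifferential_def *)
    then show "g \<in> uminus ` superdifferential f x" by (metis image_eqI minus_minus)
  next
    fix g assume "g \<in> uminus ` superdifferential f x"
    then show "g \<in> subdifferential (\<lambda>x. - f x) x"
      by (auto simp: subdifferential_def superdifferential_def *)
  qed
qed

section \<open>Gradients and Hessians of strongly convex functions\<close>

lemma has_derivative_gradient:
  fixes f :: "'a::euclidean_space \<Rightarrow> real"
  assumes "f differentiable (at x)"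
  shows "(f has_derivative (\<lambda>v. gradient f x \<bullet> v)) (at x)"
proof -
  obtain f' where f': "(f has_derivative f') (at x)" using assms by (auto simp: differentiable_def)
  define D where "D = (\<Sum>b\<in>Basis. f' b *\<^sub>R b)"
  have lin: "linear f'" using f' by (rule has_derivative_linear)
  have "f' v = v \<bullet> D" for v
  proof -
    have "f' v = f' (\<Sum>b\<in>Basis. (v \<bullet> b) *\<^sub>R b)" by (simp add: euclidean_representation)
    also have "\<dots> = (\<Sum>b\<in>Basis. (v \<bullet> b) * f' b)"
      by (simp add: linear_sum[OF lin] linear_cmul[OF lin])
    also have "\<dots> = v \<bullet> D" by (simp add: D_def inner_sum_right mult.commute)
    finally show ?thesis .
  qed
  then have "f' = (\<lambda>v. v \<bullet> D)" by (rule ext)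
  then have D: "GDERIV f x :> D" using f' by (simp add: gderiv_def)
  moreover have "D' = D" if "GDERIV f x :> D'" for D'
  proof -
    have "(\<lambda>v. v \<bullet> D') = (\<lambda>v. v \<bullet> D)"
      using that D unfolding gderiv_def by (rule has_derivative_unique)
    then have "v \<bullet> D' = v \<bullet> D" for v by (rule fun_cong)
    then show ?thesis using vector_eq_ldot[of D' D] by blast
  qed
  ultimately have "gradient f x = D" unfolding gradient_def by (rule the_equality)
  then show ?thesis using D by (simp add: gderiv_def inner_commute)
qed

lemma C2_on_has_derivative_gradient:
  assumes "C2_on U f" "x \<in> U"
  shows "(gradient f has_derivative (\<lambda>v. hessian f x *v v)) (at x)"
  using assms jacobian_works unfolding C2_on_def hessian_def by blast

text \<open>The Hessian is continuous, hence bounded on \<open>X\<close>, and the mean value inequality applies on the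
  convex set \<open>X\<close>.\<close>

lemma C2_on_gradient_lipschitz:
  fixes f :: "real ^ 'n \<Rightarrow> real"
  assumes f: "C2_on U f" and X: "compact X" "convex X" "X \<subseteq> U"
  obtains \<Lambda> where "\<Lambda>-lipschitz_on X (gradient f)"
proof -
  have "continuous_on X (hessian f)" using f X(3) continuous_on_subset unfolding C2_on_def by blast
  then have "bounded (hessian f ` X)" using X(1) compact_continuous_image compact_imp_bounded by blast
  then obtain b where b: "b > 0" "\<And>x. x \<in> X \<Longrightarrow> norm (hessian f x) \<le> b"
    unfolding bounded_pos by auto
  have "(real CARD('n) * real CARD('n) * b)-lipschitz_on X (gradient f)"
  proof (rule bounded_derivative_imp_lipschitz)
    fix x assume x: "x \<in> X"
    show "(gradient f has_derivative (\<lambda>v. hessian f x *v v)) (at x within X)"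
      using C2_on_has_derivative_gradient[OF f] x X(3) has_derivative_at_withinI by blast
    have "\<bar>hessian f x $ i $ j\<bar> \<le> b" for i j
      using component_le_norm_cart[of "hessian f x $ i" j] b(2)[OF x] Finite_Cartesian_Product.norm_nth_le[of "hessian f x" i] by simp
    then show "onorm (\<lambda>v. hessian f x *v v) \<le> real CARD('n) * real CARD('n) * b"
      by (rule onorm_le_matrix_component)
  qed (use X b in auto)
  then show thesis using that by blast
qed

text \<open>Divide the strong convexity inequality along the segment from \<open>x\<close> to \<open>y\<close> by the parameter and
  let the parameter tend to 0.\<close>

lemma strongly_convex_on_gradient_ineq:
  fixes f :: "'a::real_inner \<Rightarrow> real"
  assumes f: "strongly_convex_on \<sigma> U f" and xy: "x \<in> U" "y \<in> U"
    and g: "(f has_derivative (\<lambda>v. g \<bullet> v)) (at x)"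
  shows "f x + g \<bullet> (y - x) + \<sigma> / 2 * (norm (y - x))\<^sup>2 \<le> f y"
proof -
  define c where "c s = x + s *\<^sub>R (y - x)" for s :: real
  have "(c has_derivative (\<lambda>s. s *\<^sub>R (y - x))) (at 0)"
    unfolding c_def by (auto intro!: derivative_eq_intros)
  moreover have "(f has_derivative (\<lambda>v. g \<bullet> v)) (at (c 0))" using g by (simp add: c_def)
  ultimately have "((\<lambda>s. f (c s)) has_derivative (\<lambda>s. g \<bullet> (s *\<^sub>R (y - x)))) (at 0)"
    by (rule has_derivative_compose)
  then have "((\<lambda>s. f (c s)) has_field_derivative g \<bullet> (y - x)) (at 0)"
    unfolding has_field_derivative_def by (rule has_derivative_eq_rhs) auto
  then have "((\<lambda>s. (f (c s) - f x) / s) \<longlongrightarrow> g \<bullet> (y - x)) (at 0)"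
    by (simp add: has_field_derivative_iff c_def)
  then have lim: "((\<lambda>s. (f (c s) - f x) / s) \<longlongrightarrow> g \<bullet> (y - x)) (at_right 0)"
    by (rule filterlim_mono) (auto intro: at_le)
  have lim2: "((\<lambda>s. f y - f x - \<sigma> / 2 * (1 - s) * (norm (x - y))\<^sup>2) \<longlongrightarrow>
      f y - f x - \<sigma> / 2 * (1 - 0) * (norm (x - y))\<^sup>2) (at_right 0)"
    by (intro tendsto_intros)
  have "g \<bullet> (y - x) \<le> f y - f x - \<sigma> / 2 * (1 - 0) * (norm (x - y))\<^sup>2"
  proof (rule tendsto_le[OF _ lim2 lim])
    have "\<forall>\<^sub>F s in at_right (0::real). s \<in> {0<..<1}"
      by (rule eventually_at_right_real) simp
    then show "\<forall>\<^sub>F s in at_right 0. (f (c s) - f x) / s \<le> f y - f x - \<sigma> / 2 * (1 - s) * (norm (x - y))\<^sup>2"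
    proof eventually_elim
      case (elim s)
      have c: "c s = (1 - s) *\<^sub>R x + s *\<^sub>R y" by (simp add: c_def algebra_simps)
      have "f (c s) \<le> (1 - s) * f x + s * f y - \<sigma> / 2 * (1 - s) * s * (norm (x - y))\<^sup>2"
        using f xy elim unfolding strongly_convex_on_def c by auto
      then show ?case using elim by (simp add: field_simps)
    qed
  qed simp
  then show ?thesis by (simp add: norm_minus_commute)
qed

lemma strongly_convex_on_gradient_mono:
  fixes f :: "real ^ 'n \<Rightarrow> real"
  assumes f: "strongly_convex_on \<sigma> U f" "C2_on U f" and xy: "x \<in> U" "y \<in> U"
  shows "\<sigma> * (norm (y - x))\<^sup>2 \<le> (gradient f y - gradient f x) \<bullet> (y - x)"
proof -
  have g: "(f has_derivative (\<lambda>v. gradient f z \<bullet> v)) (at z)" if "z \<in> U" for z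
    using f(2) that has_derivative_gradient unfolding C2_on_def by blast
  show ?thesis
    using strongly_convex_on_gradient_ineq[OF f(1) xy g[OF xy(1)]]
      strongly_convex_on_gradient_ineq[OF f(1) xy(2,1) g[OF xy(2)]]
    by (simp add: norm_minus_commute inner_diff_left inner_diff_right)
qed

text \<open>Strong monotonicity of the gradient passes to the derivative, so the Hessian \<open>H\<close> satisfies
  \<open>\<sigma> * (norm v)\<^sup>2 \<le> (H *v v) \<bullet> v\<close> and is injective.\<close>

lemma matrix_inv_hessian_mult:
  fixes f :: "real ^ 'n \<Rightarrow> real"
  assumes U: "open U" and f: "strongly_convex_on \<sigma> U f" "C2_on U f" and \<sigma>: "\<sigma> > 0" and x: "x \<in> U"
  shows "matrix_inv (hessian f x) *v (hessian f x *v v) = v"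
proof -
  let ?H = "hessian f x"
  have coercive: "\<sigma> * (norm v)\<^sup>2 \<le> (?H *v v) \<bullet> v" for v
  proof -
    define c where "c s = x + s *\<^sub>R v" for s :: real
    have "(c has_derivative (\<lambda>s. s *\<^sub>R v)) (at 0)"
      unfolding c_def by (auto intro!: derivative_eq_intros)
    moreover have "(gradient f has_derivative (\<lambda>v. ?H *v v)) (at (c 0))"
      using C2_on_has_derivative_gradient[OF f(2) x] by (simp add: c_def)
    ultimately have "((\<lambda>s. gradient f (c s)) has_derivative (\<lambda>s. ?H *v (s *\<^sub>R v))) (at 0)"
      by (rule has_derivative_compose)
    then have "((\<lambda>s. gradient f (c s) \<bullet> v) has_derivative (\<lambda>s. (?H *v (s *\<^sub>R v)) \<bullet> v)) (at 0)"
      by (rule has_derivative_inner_left)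
    then have "((\<lambda>s. gradient f (c s) \<bullet> v) has_field_derivative (?H *v v) \<bullet> v) (at 0)"
      unfolding has_field_derivative_def
      by (rule has_derivative_eq_rhs) (auto simp: matrix_vector_mult_scaleR)
    then have "((\<lambda>s. (gradient f (c s) \<bullet> v - gradient f x \<bullet> v) / s) \<longlongrightarrow> (?H *v v) \<bullet> v) (at 0)"
      by (simp add: has_field_derivative_iff c_def)
    then show ?thesis
    proof (rule tendsto_lowerbound)
      have "(c \<longlongrightarrow> c 0) (at 0)" unfolding c_def by (intro tendsto_intros)
      then have "\<forall>\<^sub>F s in at 0. c s \<in> U"
        by (rule topological_tendstoD) (use U x in \<open>auto simp: c_def\<close>)
      moreover have "\<forall>\<^sub>F s in at (0::real). s \<noteq> 0" by (rule eventually_neq_at_within)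
      ultimately show "\<forall>\<^sub>F s in at 0. \<sigma> * (norm v)\<^sup>2 \<le> (gradient f (c s) \<bullet> v - gradient f x \<bullet> v) / s"
      proof eventually_elim
        case (elim s)
        have "s\<^sup>2 * (\<sigma> * (norm v)\<^sup>2) \<le> s * (gradient f (c s) \<bullet> v - gradient f x \<bullet> v)"
          using strongly_convex_on_gradient_mono[OF f x elim(1)]
          by (simp add: c_def power_mult_distrib inner_diff_left algebra_simps)
        also have "\<dots> = s\<^sup>2 * ((gradient f (c s) \<bullet> v - gradient f x \<bullet> v) / s)"
          using elim(2) by (simp add: power2_eq_square)
        finally show ?case by (rule mult_left_le_imp_le) (use elim(2) in simp)
      qed
    qed simp
  qed
  have "inj ((*v) ?H)"
  proof (rule injI)
    fix v w assume "?H *v v = ?H *v w"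
    then have "?H *v (v - w) = 0" by (simp add: matrix_vector_mult_diff_distrib)
    then have "\<sigma> * (norm (v - w))\<^sup>2 \<le> 0" using coercive[of "v - w"] by simp
    then show "v = w" using \<sigma> by (simp add: mult_le_0_iff)
  qed
  then have "invertible ?H" by (simp add: invertible_left_inverse matrix_left_invertible_injective)
  then have "matrix_inv ?H ** ?H = mat 1"
    unfolding matrix_inv_def invertible_def by (rule someI2_ex) blast
  then show ?thesis by (simp add: matrix_vector_mul_assoc)
qed

section \<open>The saddle-point dynamics\<close>

lemma lipschitz_imp_absolutely_continuous_on:
  assumes f: "K-lipschitz_on I f"
  shows "absolutely_continuous_on I f"
  unfolding absolutely_continuous_on_def
proof (intro allI impI)
  fix \<epsilon> :: real assume \<epsilon>: "\<epsilon> > 0"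
  have K: "K \<ge> 0" using f lipschitz_on_nonneg by blast
  show "\<exists>\<delta>>0. \<forall>D :: (real \<times> real) set.
        finite D \<and> (\<forall>(a, b)\<in>D. a < b \<and> {a..b} \<subseteq> I) \<and>
        pairwise (\<lambda>(a, b) (c, d). {a<..<b} \<inter> {c<..<d} = {}) D \<and>
        (\<Sum>(a, b)\<in>D. b - a) < \<delta> \<longrightarrow> (\<Sum>(a, b)\<in>D. dist (f a) (f b)) < \<epsilon>"
  proof (intro exI[of _ "\<epsilon> / (K + 1)"] conjI allI impI)
    show "0 < \<epsilon> / (K + 1)" using \<epsilon> K by simp
    fix D :: "(real \<times> real) set"
    assume D: "finite D \<and> (\<forall>(a, b)\<in>D. a < b \<and> {a..b} \<subseteq> I) \<and>
        pairwise (\<lambda>(a, b) (c, d). {a<..<b} \<inter> {c<..<d} = {}) D \<and>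
        (\<Sum>(a, b)\<in>D. b - a) < \<epsilon> / (K + 1)"
    have "(\<Sum>(a, b)\<in>D. dist (f a) (f b)) \<le> (\<Sum>(a, b)\<in>D. K * (b - a))"
    proof (rule sum_mono, clarify)
      fix a b assume "(a, b) \<in> D"
      then have "a < b" "{a..b} \<subseteq> I" using D by auto
      then have "a \<in> I" "b \<in> I" by auto
      then show "dist (f a) (f b) \<le> K * (b - a)"
        using lipschitz_onD[OF f, of a b] \<open>a < b\<close> by (simp add: dist_real_def)
    qed
    also have "\<dots> = K * (\<Sum>(a, b)\<in>D. b - a)"
      by (simp add: sum_distrib_left case_prod_unfold)
    also have "\<dots> \<le> K * (\<epsilon> / (K + 1))" using D K by (intro mult_left_mono) auto
    also have "\<dots> < \<epsilon>" using \<epsilon> K by (simp add: field_simps)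
    finally show "(\<Sum>(a, b)\<in>D. dist (f a) (f b)) < \<epsilon>" .
  qed
qed

text \<open>Turns the integrated inequality delivered by the mirror flow into the pointwise one.\<close>

lemma variational_inequality_of_derivative:
  fixes P z :: "real \<Rightarrow> 'a::real_inner"
  assumes q: "(P has_vector_derivative q) (at t)"
    and ev: "\<And>\<epsilon>. 0 < \<epsilon> \<Longrightarrow> \<forall>\<^sub>F s in at_right t. (P t - P s) \<bullet> v \<le> (s - t) * (b + \<epsilon>)"
  shows "(- q) \<bullet> v \<le> b"
proof (rule field_le_epsilon)
  fix \<epsilon> :: real assume \<epsilon>: "0 < \<epsilon>"
  have "((\<lambda>s. - (P s \<bullet> v)) has_derivative (\<lambda>s. - ((s *\<^sub>R q) \<bullet> v))) (at t)"
    using q unfolding has_vector_derivative_def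
    by (intro has_derivative_minus has_derivative_inner_left)
  then have "((\<lambda>s. - (P s \<bullet> v)) has_field_derivative (- q) \<bullet> v) (at t)"
    unfolding has_field_derivative_def by (rule has_derivative_eq_rhs) auto
  then have "((\<lambda>s. (- (P s \<bullet> v) - - (P t \<bullet> v)) / (s - t)) \<longlongrightarrow> (- q) \<bullet> v) (at t)"
    by (simp only: has_field_derivative_iff)
  then have "((\<lambda>s. (- (P s \<bullet> v) - - (P t \<bullet> v)) / (s - t)) \<longlongrightarrow> (- q) \<bullet> v) (at_right t)"
    by (rule filterlim_mono) (auto intro: at_le)
  then show "(- q) \<bullet> v \<le> b + \<epsilon>"
  proof (rule tendsto_upperbound)
    show "\<forall>\<^sub>F s in at_right t. (- (P s \<bullet> v) - - (P t \<bullet> v)) / (s - t) \<le> b + \<epsilon>"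
      using ev[OF \<epsilon>] eventually_at_right_less[of t]
      by eventually_elim (simp add: field_simps inner_diff_left)
  qed simp
qed

lemma C2_on_gradient_along_curve:
  assumes "C2_on U f" "x t \<in> U" "(x has_vector_derivative x') (at t)"
  shows "((\<lambda>s. gradient f (x s)) has_vector_derivative hessian f (x t) *v x') (at t)"
proof -
  have "((\<lambda>s. gradient f (x s)) has_derivative (\<lambda>s. hessian f (x t) *v (s *\<^sub>R x'))) (at t)"
    using assms(3) C2_on_has_derivative_gradient[OF assms(1,2)]
    unfolding has_vector_derivative_def by (rule has_derivative_compose)
  then show ?thesis unfolding has_vector_derivative_def by (simp add: matrix_vector_mult_scaleR)
qed

theorem lemma3:
  fixes X :: "(real ^ 'n) set" and Y :: "(real ^ 'm) set"
    and L :: "real ^ 'n \<Rightarrow> real ^ 'm \<Rightarrow> ereal"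
    and Rx :: "real ^ 'n \<Rightarrow> ereal" and R\<gamma> :: "real ^ 'm \<Rightarrow> ereal"
    and U :: "(real ^ 'n) set" and V :: "(real ^ 'm) set"
    and \<sigma> :: real
    and x0 :: "real ^ 'n" and \<gamma>0 :: "real ^ 'm"
  assumes X: "X \<noteq> {}" "convex X" "compact X"
    and Y: "Y \<noteq> {}" "convex Y" "compact Y"
    and L_convex: "\<And>\<gamma>. convex_ereal (\<lambda>x. L x \<gamma>)"
    and L_concave: "\<And>x. concave_ereal (\<lambda>\<gamma>. L x \<gamma>)"
    and A1_saddle: "saddle_points X Y L \<noteq> {}" "compact (saddle_points X Y L)"
    and A1_strict: "\<And>x \<gamma>. (x, \<gamma>) \<in> (X \<times> Y) - saddle_points X Y L \<Longrightarrow>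
        \<exists>(xs, \<gamma>s) \<in> saddle_points X Y L. L xs \<gamma> < L xs \<gamma>s \<or> L xs \<gamma>s < L x \<gamma>s"
    and A2_usc: "\<And>x. x \<in> X \<Longrightarrow> usc (\<lambda>\<gamma>. L x \<gamma>)"
    and A2_lsc: "\<And>\<gamma>. \<gamma> \<in> Y \<Longrightarrow> lsc (\<lambda>x. L x \<gamma>)"
    and A3_nonempty: "\<And>x \<gamma>. x \<in> X \<Longrightarrow> \<gamma> \<in> Y \<Longrightarrow>
        subdifferential (\<lambda>y. L y \<gamma>) x \<times> superdifferential (L x) \<gamma> \<noteq> {}"
    and A3_bounded: "\<exists>G>0. \<forall>x\<in>X. \<forall>\<gamma>\<in>Y.
        (\<forall>g \<in> subdifferential (\<lambda>y. L y \<gamma>) x. norm g \<le> G) \<and>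
        (\<forall>g \<in> superdifferential (L x) \<gamma>. norm g \<le> G)"
    and \<sigma>: "\<sigma> > 0"
    and U: "open U" "X \<subseteq> U"
    and Rx: "\<And>x. x \<in> U \<Longrightarrow> \<bar>Rx x\<bar> \<noteq> \<infinity>" "C2_on U (\<lambda>x. real_of_ereal (Rx x))"
        "strongly_convex_on \<sigma> U (\<lambda>x. real_of_ereal (Rx x))"
    and V: "open V" "Y \<subseteq> V"
    and R\<gamma>: "\<And>\<gamma>. \<gamma> \<in> V \<Longrightarrow> \<bar>R\<gamma> \<gamma>\<bar> \<noteq> \<infinity>" "C2_on V (\<lambda>\<gamma>. real_of_ereal (R\<gamma> \<gamma>))"
        "strongly_convex_on \<sigma> V (\<lambda>\<gamma>. real_of_ereal (R\<gamma> \<gamma>))"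
    and init: "x0 \<in> X" "\<gamma>0 \<in> Y"
  shows "\<exists>(x :: real \<Rightarrow> real ^ 'n) (\<gamma> :: real \<Rightarrow> real ^ 'm).
    (\<forall>t\<ge>0. x t \<in> X \<and> \<gamma> t \<in> Y) \<and>
    absolutely_continuous_on {0..} (\<lambda>t. (x t, \<gamma> t)) \<and>
    x 0 = x0 \<and> \<gamma> 0 = \<gamma>0 \<and>
    (AE t in lebesgue. t \<ge> 0 \<longrightarrow>
      (\<exists>x' \<gamma>'.
        (x has_vector_derivative x') (at t within {0..}) \<and>
        (\<gamma> has_vector_derivative \<gamma>') (at t within {0..}) \<and>
        x' \<in> (\<lambda>w. - (matrix_inv (hessian (\<lambda>x. real_of_ereal (Rx x)) (x t)) *v w)) `
          {g + \<eta> | g \<eta>. g \<in> subdifferential (\<lambda>y. L y (\<gamma> t)) (x t) \<and> \<eta> \<in> normal_cone X (x t)} \<and>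
        \<gamma>' \<in> (\<lambda>w. matrix_inv (hessian (\<lambda>\<gamma>. real_of_ereal (R\<gamma> \<gamma>)) (\<gamma> t)) *v w) `
          {g - \<eta> | g \<eta>. g \<in> superdifferential (L (x t)) (\<gamma> t) \<and> \<eta> \<in> normal_cone Y (\<gamma> t)}))"
proof -
  let ?rx = "\<lambda>x. real_of_ereal (Rx x)" and ?ry = "\<lambda>\<gamma>. real_of_ereal (R\<gamma> \<gamma>)"
  let ?Hx = "hessian ?rx" and ?Hy = "hessian ?ry"
  let ?Z = "X \<times> Y"
  obtain G where G: "G > 0"
      "\<And>x \<gamma> g. x \<in> X \<Longrightarrow> \<gamma> \<in> Y \<Longrightarrow> g \<in> subdifferential (\<lambda>y. L y \<gamma>) x \<Longrightarrow> norm g \<le> G"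
      "\<And>x \<gamma> g. x \<in> X \<Longrightarrow> \<gamma> \<in> Y \<Longrightarrow> g \<in> superdifferential (L x) \<gamma> \<Longrightarrow> norm g \<le> G"
    using A3_bounded by blast
  have sub: "subdifferential (\<lambda>y. L y \<gamma>) x \<noteq> {}" "bounded (subdifferential (\<lambda>y. L y \<gamma>) x)"
      "superdifferential (L x) \<gamma> \<noteq> {}" if "x \<in> X" "\<gamma> \<in> Y" for x \<gamma>
    using A3_nonempty[OF that] G(2)[OF that] by (auto simp: bounded_iff)
  have sup: "subdifferential (\<lambda>\<delta>. - L x \<delta>) \<gamma> \<noteq> {}" "bounded (subdifferential (\<lambda>\<delta>. - L x \<delta>) \<gamma>)"
    if "x \<in> X" "\<gamma> \<in> Y" for x \<gamma>
    using sub(3)[OF that] G(3)[OF that] by (auto simp: subdifferential_uminus bounded_iff)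
  define l where "l x \<gamma> = real_of_ereal (L x \<gamma>)" for x \<gamma>
  have l: "L x \<gamma> = ereal (l x \<gamma>)" if "x \<in> X" "\<gamma> \<in> Y" for x \<gamma>
    using finite_of_bounded_subdifferential[OF sub(1,2)[OF that]] unfolding l_def by auto
  have subD: "l x \<gamma> + g \<bullet> (y - x) \<le> l y \<gamma>"
    if "x \<in> X" "y \<in> X" "\<gamma> \<in> Y" "g \<in> subdifferential (\<lambda>y. L y \<gamma>) x" for x y \<gamma> g
  proof -
    have "L x \<gamma> + ereal (g \<bullet> (y - x)) \<le> L y \<gamma>" using that(4) by (simp add: subdifferential_def)
    then show ?thesis using that by (simp add: l)
  qed
  have supD: "l x \<delta> \<le> l x \<gamma> + g \<bullet> (\<delta> - \<gamma>)"
    if "x \<in> X" "\<gamma> \<in> Y" "\<delta> \<in> Y" "g \<in> superdifferential (L x) \<gamma>" for x \<gamma> \<delta> g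
  proof -
    have "L x \<delta> \<le> L x \<gamma> + ereal (g \<bullet> (\<delta> - \<gamma>))" using that(4) by (simp add: superdifferential_def)
    then show ?thesis using that by (simp add: l)
  qed
  \<comment> \<open>Bounded subgradients make \<open>l\<close> Lipschitz in each variable. For a fixed second argument,
    the bifunction \<open>\<Phi>\<close> below depends on one variable in each summand and is thus continuous.\<close>
  have lip_x: "G-lipschitz_on X (\<lambda>x. l x \<gamma>)" if \<gamma>: "\<gamma> \<in> Y" for \<gamma>
  proof -
    have le: "l x \<gamma> - l y \<gamma> \<le> G * norm (x - y)" if xy: "x \<in> X" "y \<in> X" for x y
    proof -
      obtain g where g: "g \<in> subdifferential (\<lambda>y. L y \<gamma>) x" using sub(1)[OF xy(1) \<gamma>] by blast
      have "l x \<gamma> - l y \<gamma> \<le> g \<bullet> (x - y)" using subD[OF xy \<gamma> g] by (simp add: inner_diff_right)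
      also have "\<dots> \<le> norm g * norm (x - y)" by (rule norm_cauchy_schwarz)
      also have "\<dots> \<le> G * norm (x - y)" using G(2)[OF xy(1) \<gamma> g] by (simp add: mult_right_mono)
      finally show ?thesis .
    qed
    show ?thesis
    proof (rule lipschitz_onI)
      show "dist (l u \<gamma>) (l v \<gamma>) \<le> G * dist u v" if "u \<in> X" "v \<in> X" for u v
        using le[OF that] le[OF that(2,1)] by (simp add: dist_norm abs_le_iff norm_minus_commute[of v u])
    qed (use G(1) in simp)
  qed
  have lip_y: "G-lipschitz_on Y (\<lambda>\<gamma>. l x \<gamma>)" if x: "x \<in> X" for x
  proof -
    have le: "l x \<gamma> - l x \<delta> \<le> G * norm (\<gamma> - \<delta>)" if yz: "\<gamma> \<in> Y" "\<delta> \<in> Y" for \<gamma> \<delta>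
    proof -
      obtain g where g: "g \<in> superdifferential (L x) \<delta>" using sub(3)[OF x yz(2)] by blast
      have "l x \<gamma> - l x \<delta> \<le> g \<bullet> (\<gamma> - \<delta>)" using supD[OF x yz(2,1) g] by simp
      also have "\<dots> \<le> norm g * norm (\<gamma> - \<delta>)" by (rule norm_cauchy_schwarz)
      also have "\<dots> \<le> G * norm (\<gamma> - \<delta>)" using G(3)[OF x yz(2) g] by (simp add: mult_right_mono)
      finally show ?thesis .
    qed
    show ?thesis
    proof (rule lipschitz_onI)
      show "dist (l x u) (l x v) \<le> G * dist u v" if "u \<in> Y" "v \<in> Y" for u v
        using le[OF that] le[OF that(2,1)] by (simp add: dist_norm abs_le_iff norm_minus_commute[of v u])
    qed (use G(1) in simp)
  qed
  \<comment> \<open>The Nikaido-Isoda bifunction of the saddle problem. It encodes both relative subdifferentials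
    at once: if \<open>w\<close> agrees with \<open>z\<close> in one component, the subgradient inequality in the other one is left.\<close>
  define \<Phi> where "\<Phi> z w = l (fst w) (snd z) - l (fst z) (snd w)"
    for z w :: "(real ^ 'n) \<times> (real ^ 'm)"
  \<comment> \<open>The mirror map of the product space is the gradient of the separable function \<open>R\<close>.\<close>
  define p where "p z = (gradient ?rx (fst z), gradient ?ry (snd z))"
    for z :: "(real ^ 'n) \<times> (real ^ 'm)"
  define R where "R z = ?rx (fst z) + ?ry (snd z)"
    for z :: "(real ^ 'n) \<times> (real ^ 'm)"
  have derx: "(?rx has_derivative (\<lambda>v. gradient ?rx x \<bullet> v)) (at x)" if "x \<in> X" for x
    using Rx(2) U that has_derivative_gradient unfolding C2_on_def by blast
  have dery: "(?ry has_derivative (\<lambda>v. gradient ?ry y \<bullet> v)) (at y)" if "y \<in> Y" for y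
    using R\<gamma>(2) V that has_derivative_gradient unfolding C2_on_def by blast
  have R: "(R has_derivative (\<lambda>v. p z \<bullet> v)) (at z within ?Z)" if z: "z \<in> ?Z" for z
  proof -
    have "((\<lambda>z. ?rx (fst z)) has_derivative (\<lambda>v. gradient ?rx (fst z) \<bullet> fst v)) (at z within ?Z)"
      by (rule has_derivative_compose[OF _ derx]) (use z in \<open>auto intro!: derivative_eq_intros\<close>)
    moreover have "((\<lambda>z. ?ry (snd z)) has_derivative (\<lambda>v. gradient ?ry (snd z) \<bullet> snd v)) (at z within ?Z)"
      by (rule has_derivative_compose[OF _ dery]) (use z in \<open>auto intro!: derivative_eq_intros\<close>)
    ultimately show ?thesis
      unfolding R_def p_def inner_prod_def fst_conv snd_conv by (rule has_derivative_add)
  qed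
  have mono: "\<sigma> * (norm (z' - z))\<^sup>2 \<le> (p z' - p z) \<bullet> (z' - z)" if "z \<in> ?Z" "z' \<in> ?Z" for z z'
  proof -
    have "\<sigma> * (norm (fst z' - fst z))\<^sup>2 \<le> (gradient ?rx (fst z') - gradient ?rx (fst z)) \<bullet> (fst z' - fst z)"
      by (rule strongly_convex_on_gradient_mono[OF Rx(3,2)]) (use that U in auto)
    moreover have "\<sigma> * (norm (snd z' - snd z))\<^sup>2 \<le> (gradient ?ry (snd z') - gradient ?ry (snd z)) \<bullet> (snd z' - snd z)"
      by (rule strongly_convex_on_gradient_mono[OF R\<gamma>(3,2)]) (use that V in auto)
    ultimately show ?thesis
      by (simp add: p_def inner_prod_def norm_prod_def distrib_left)
  qed
  obtain \<Lambda>x where \<Lambda>x: "\<Lambda>x-lipschitz_on X (gradient ?rx)"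
    by (rule C2_on_gradient_lipschitz[OF Rx(2) X(3,2) U(2)])
  obtain \<Lambda>y where \<Lambda>y: "\<Lambda>y-lipschitz_on Y (gradient ?ry)"
    by (rule C2_on_gradient_lipschitz[OF R\<gamma>(2) Y(3,2) V(2)])
  have lip: "(sqrt ((\<Lambda>x * 1)\<^sup>2 + (\<Lambda>y * 1)\<^sup>2))-lipschitz_on ?Z p"
    unfolding p_def
  proof (rule lipschitz_on_Pair)
    have f: "1-lipschitz_on ?Z fst" and s: "1-lipschitz_on ?Z snd"
      by (rule lipschitz_onI; simp add: dist_fst_le dist_snd_le)+
    have "\<Lambda>x-lipschitz_on (fst ` ?Z) (gradient ?rx)" "\<Lambda>y-lipschitz_on (snd ` ?Z) (gradient ?ry)"
      using \<Lambda>x \<Lambda>y X(1) Y(1) by simp_all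
    from lipschitz_on_compose2[OF f this(1)] lipschitz_on_compose2[OF s this(2)]
    show "(\<Lambda>x * 1)-lipschitz_on ?Z (\<lambda>z. gradient ?rx (fst z))"
        "(\<Lambda>y * 1)-lipschitz_on ?Z (\<lambda>z. gradient ?ry (snd z))" .
  qed
  have sel: "\<exists>f. norm f \<le> 2 * G \<and> (\<forall>w\<in>?Z. f \<bullet> (w - z) \<le> \<Phi> z w)" if z: "z \<in> ?Z" for z
  proof -
    obtain x \<gamma> where z: "z = (x, \<gamma>)" "x \<in> X" "\<gamma> \<in> Y" using z by auto
    obtain g g' where g: "g \<in> subdifferential (\<lambda>y. L y \<gamma>) x" "g' \<in> superdifferential (L x) \<gamma>"
      using A3_nonempty[OF z(2,3)] by auto
    have "norm (g, - g') \<le> norm g + norm (- g')" by (rule norm_Pair_le)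
    also have "\<dots> \<le> 2 * G" using G(2)[OF z(2,3) g(1)] G(3)[OF z(2,3) g(2)] by simp
    finally have "norm (g, - g') \<le> 2 * G" .
    moreover have "(g, - g') \<bullet> (w - z) \<le> \<Phi> z w" if w: "w \<in> ?Z" for w
    proof -
      obtain y \<delta> where w: "w = (y, \<delta>)" "y \<in> X" "\<delta> \<in> Y" using w by auto
      show ?thesis
        using subD[OF z(2) w(2) z(3) g(1)] supD[OF z(2,3) w(3) g(2)]
        by (simp add: \<Phi>_def z(1) w(1) inner_prod_def)
    qed
    ultimately show ?thesis by blast
  qed
  have cont: "continuous_on ?Z (\<lambda>z. \<Phi> z w)" if w: "w \<in> ?Z" for w
    unfolding \<Phi>_def
  proof (rule continuous_on_diff)
    show "continuous_on ?Z (\<lambda>z. l (fst w) (snd z))"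
      by (rule continuous_on_compose2[OF lipschitz_on_continuous_on[OF lip_y]])
         (use w in \<open>auto intro: continuous_intros\<close>)
    show "continuous_on ?Z (\<lambda>z. l (fst z) (snd w))"
      by (rule continuous_on_compose2[OF lipschitz_on_continuous_on[OF lip_x]])
         (use w in \<open>auto intro: continuous_intros\<close>)
  qed
  have Z: "compact ?Z" "convex ?Z" "(x0, \<gamma>0) \<in> ?Z"
    using X Y init by (auto intro: compact_Times convex_Times)
  obtain z where z: "z 0 = (x0, \<gamma>0)" "\<And>t. z t \<in> ?Z" "(2 * G / \<sigma>)-lipschitz_on UNIV z"
    and flow: "\<And>t y \<epsilon>. 0 \<le> t \<Longrightarrow> y \<in> ?Z \<Longrightarrow> 0 < \<epsilon> \<Longrightarrow>
      \<forall>\<^sub>F s in at_right t. (p (z t) - p (z s)) \<bullet> (y - z t) \<le> (s - t) * (\<Phi> (z t) y + \<epsilon>)"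
    using mirror_flow_existence[OF Z R mono \<sigma> lip sel cont] by blast
  define x where "x t = fst (z t)" for t
  define \<gamma> where "\<gamma> t = snd (z t)" for t
  have zxy: "z t = (x t, \<gamma> t)" for t by (simp add: x_def \<gamma>_def)
  have inZ: "x t \<in> X" "\<gamma> t \<in> Y" for t using z(2)[of t] by (auto simp: zxy)
  let ?incl = "\<lambda>t. \<exists>x' \<gamma>'.
        (x has_vector_derivative x') (at t within {0..}) \<and>
        (\<gamma> has_vector_derivative \<gamma>') (at t within {0..}) \<and>
        x' \<in> (\<lambda>w. - (matrix_inv (?Hx (x t)) *v w)) `
          {g + \<eta> | g \<eta>. g \<in> subdifferential (\<lambda>y. L y (\<gamma> t)) (x t) \<and> \<eta> \<in> normal_cone X (x t)} \<and>
        \<gamma>' \<in> (\<lambda>w. matrix_inv (?Hy (\<gamma> t)) *v w) `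
          {g - \<eta> | g \<eta>. g \<in> superdifferential (L (x t)) (\<gamma> t) \<and> \<eta> \<in> normal_cone Y (\<gamma> t)}"
  have incl: "?incl t" if t: "0 \<le> t" and diff: "z differentiable (at t)" for t
  proof -
    obtain z' where z': "(z has_vector_derivative z') (at t)"
      using diff vector_derivative_works by blast
    define x' where "x' = fst z'"
    define \<gamma>' where "\<gamma>' = snd z'"
    have x': "(x has_vector_derivative x') (at t)" and \<gamma>': "(\<gamma> has_vector_derivative \<gamma>') (at t)"
      using has_derivative_fst[OF z'[unfolded has_vector_derivative_def]]
        has_derivative_snd[OF z'[unfolded has_vector_derivative_def]]
      by (simp_all add: has_vector_derivative_def x_def[abs_def] \<gamma>_def[abs_def] x'_def \<gamma>'_def)
    have "((\<lambda>s. p (z s)) has_vector_derivative (?Hx (x t) *v x', ?Hy (\<gamma> t) *v \<gamma>')) (at t)"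
      unfolding p_def zxy fst_conv snd_conv
      by (intro has_vector_derivative_Pair C2_on_gradient_along_curve[OF Rx(2) _ x']
          C2_on_gradient_along_curve[OF R\<gamma>(2) _ \<gamma>']) (use inZ U V in auto)
    from variational_inequality_of_derivative[OF this flow[OF t]]
    have VI: "(- (?Hx (x t) *v x', ?Hy (\<gamma> t) *v \<gamma>')) \<bullet> (w - z t) \<le> \<Phi> (z t) w" if "w \<in> ?Z" for w
      using that by blast
    \<comment> \<open>Test with the second component unchanged, then with the first component unchanged.\<close>
    obtain g \<eta> where g: "g \<in> subdifferential (\<lambda>y. L y (\<gamma> t)) (x t)" "\<eta> \<in> normal_cone X (x t)"
        "- (?Hx (x t) *v x') = g + \<eta>"
    proof (rule restricted_subgradient_decomposition[OF L_convex X(2) inZ(1) sub(1,2)[OF inZ]])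
      fix y assume y: "y \<in> X"
      show "L (x t) (\<gamma> t) + ereal (- (?Hx (x t) *v x') \<bullet> (y - x t)) \<le> L y (\<gamma> t)"
        using VI[of "(y, \<gamma> t)"] y inZ[of t] by (simp add: l zxy \<Phi>_def inner_prod_def)
    qed
    \<comment> \<open>The concave player is treated as the convex one for \<open>- L\<close>, so signs flip on the way back.\<close>
    obtain g' \<eta>' where g': "g' \<in> subdifferential (\<lambda>\<delta>. - L (x t) \<delta>) (\<gamma> t)" "\<eta>' \<in> normal_cone Y (\<gamma> t)"
        "- (?Hy (\<gamma> t) *v \<gamma>') = g' + \<eta>'"
    proof (rule restricted_subgradient_decomposition[OF convex_ereal_uminus[OF L_concave] Y(2) inZ(2) sup[OF inZ]])
      fix \<delta> assume \<delta>: "\<delta> \<in> Y"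
      show "- L (x t) (\<gamma> t) + ereal (- (?Hy (\<gamma> t) *v \<gamma>') \<bullet> (\<delta> - \<gamma> t)) \<le> - L (x t) \<delta>"
        using VI[of "(x t, \<delta>)"] \<delta> inZ[of t] by (simp add: l zxy \<Phi>_def inner_prod_def)
    qed
    have "- g' \<in> superdifferential (L (x t)) (\<gamma> t)"
      using g'(1) by (auto simp: subdifferential_uminus)
    moreover have "\<gamma>' = matrix_inv (?Hy (\<gamma> t)) *v (- g' - \<eta>')"
    proof -
      have "?Hy (\<gamma> t) *v \<gamma>' = - g' - \<eta>'" using g'(3) by (metis add.inverse_inverse minus_add_distrib diff_conv_add_uminus)
      then show ?thesis
        using matrix_inv_hessian_mult[OF V(1) R\<gamma>(3,2) \<sigma>, of "\<gamma> t" \<gamma>'] inZ(2)[of t] V(2) by auto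
    qed
    moreover have "x' = - (matrix_inv (?Hx (x t)) *v (g + \<eta>))"
    proof -
      have "matrix_inv (?Hx (x t)) *v (?Hx (x t) *v x') = x'"
        using matrix_inv_hessian_mult[OF U(1) Rx(3,2) \<sigma>, of "x t" x'] inZ(1)[of t] U(2) by auto
      moreover have "?Hx (x t) *v x' = - (g + \<eta>)" using g(3) by (metis add.inverse_inverse)
      ultimately show ?thesis
        using linear_neg[OF matrix_vector_mul_linear[of "matrix_inv (?Hx (x t))"], of "g + \<eta>"] by simp
    qed
    ultimately show ?thesis
      using g(1,2) g'(2) has_vector_derivative_at_within[OF x'] has_vector_derivative_at_within[OF \<gamma>']
      by (intro exI[of _ x'] exI[of _ \<gamma>'] conjI) blast+
  qed
  have "AE t in lebesgue. t \<ge> 0 \<longrightarrow> ?incl t"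
  proof (rule AE_I')
    show "{t. \<not> z differentiable (at t)} \<in> null_sets lebesgue"
      using lipschitz_differentiable_ae[OF z(3)] by (simp add: negligible_iff_null_sets)
    show "{t \<in> space lebesgue. \<not> (t \<ge> 0 \<longrightarrow> ?incl t)} \<subseteq> {t. \<not> z differentiable (at t)}"
      using incl by blast
  qed
  moreover have "absolutely_continuous_on {0..} (\<lambda>t. (x t, \<gamma> t))"
  proof -
    have "(\<lambda>t. (x t, \<gamma> t)) = z" by (simp add: zxy fun_eq_iff)
    then show ?thesis
      using lipschitz_imp_absolutely_continuous_on[OF lipschitz_on_subset[OF z(3) subset_UNIV]] by simp
  qed
  moreover have "x 0 = x0" "\<gamma> 0 = \<gamma>0" using z(1) by (simp_all add: x_def \<gamma>_def)
  ultimately show ?thesis using inZ by blast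
qed

end
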